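(* Let $\rho$ and $\tau$ be simple types with $\rho\trianglelefteq\tau$. Then $head(\rho)=head(\tau)$, and each argument of $\rho$ is a retract of a delayed argument of $\tau$; that is, if $\rho=\rho_1\to\cdots\to\rho_\ell\to a$ with $a$ an atom, then for every $i\le \ell$ there is a delayed argument $\tau'$ of $\tau$ such that $\rho_i\trianglelefteq\tau'$.
   Context: Simple types are built from type variables (atoms) $a,b,c,\dots$ (many distinct atoms) with $\to$. If $\tau=\tau_1\to\cdots\to\tau_k\to a$ with $a$ an atom, then $head(\tau)=a$ and $\tau_1,\dots,\tau_k$ are the arguments of $\tau$. Terms are simply typed $\lambda$-terms in Church style. Retraction: $\rho\trianglelefteq\tau$ ("$\rho$ is a retract of $\tau$") means that there are a type environment $E$ and terms $C$ (the coder), $D$ (the decoder) with $E,(x:\rho)\vdash C:\tau$, $E\vdash D:\tau\to\rho$, $x\notin FV(D)$, and $DC=_{\beta\eta}x$. The types of the free variables declared in $E$ are arbitrary, and no affinity is required. Parts: if $\tau=\tau_1\to\cdots\to\tau_n\to a$ with $a$ an atom, then each $\tau_i$ is a part of $\tau$ under the path $a$ (a one-letter word over atoms); and if $\sigma$ is a part of some $\tau_i$ under a path (word) $w$, then $\sigma$ is a part of $\tau$ under the path $wa$. A delayed argument of $\tau$ is a part of $\tau$ under a path of the form $a^k$ (the letter $a$ repeated $k$ times, $a$ an atom) with $k$ odd. *)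

theory Defs
  imports Main
begin

section \<open>Simple types\<close>

text \<open>The type parameter ranges over arbitrary types of atoms, in particular infinite ones.\<close>

datatype 'a ty = Atom 'a | Fun "'a ty" "'a ty" (infixr \<open>\<rightarrow>\<^sub>t\<close> 65)

primrec head :: "'a ty \<Rightarrow> 'a" where
  "head (Atom a) = a"
| "head (\<sigma> \<rightarrow>\<^sub>t \<tau>) = head \<tau>"

primrec args :: "'a ty \<Rightarrow> 'a ty list" where
  "args (Atom a) = []"
| "args (\<sigma> \<rightarrow>\<^sub>t \<tau>) = \<sigma> # args \<tau>"

lemma ty_decomp: "foldr (\<rightarrow>\<^sub>t) (args \<tau>) (Atom (head \<tau>)) = \<tau>"
  by (induction \<tau>) simp_all

text \<open>\<open>part w \<sigma> \<tau>\<close>: \<open>\<sigma>\<close> is a part of \<open>\<tau>\<close> under the path \<open>w\<close>; the head of the outermost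
  type is the last letter of the path.\<close>

inductive part :: "'a list \<Rightarrow> 'a ty \<Rightarrow> 'a ty \<Rightarrow> bool" where
  part_arg: "\<sigma> \<in> set (args \<tau>) \<Longrightarrow> part [head \<tau>] \<sigma> \<tau>"
| part_nested: "\<tau>' \<in> set (args \<tau>) \<Longrightarrow> part w \<sigma> \<tau>' \<Longrightarrow> part (w @ [head \<tau>]) \<sigma> \<tau>"

definition delayed_argument :: "'a ty \<Rightarrow> 'a ty \<Rightarrow> bool" where
  "delayed_argument \<sigma> \<tau> \<longleftrightarrow> (\<exists>a k. odd k \<and> part (replicate k a) \<sigma> \<tau>)"

section \<open>Church-style terms\<close>

text \<open>Terms use de Bruijn indices, so they are identified up to \<open>\<alpha>\<close>-conversion; abstractions carry
  the type of the bound variable. A type environment is the list of the types of the free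
  variables \<open>0, 1, \<dots>\<close>.\<close>

datatype 'a tm = Var nat | App "'a tm" "'a tm" | Lam "'a ty" "'a tm"

primrec lift :: "'a tm \<Rightarrow> nat \<Rightarrow> 'a tm" where
  "lift (Var i) k = (if i < k then Var i else Var (Suc i))"
| "lift (App s t) k = App (lift s k) (lift t k)"
| "lift (Lam \<sigma> t) k = Lam \<sigma> (lift t (Suc k))"

text \<open>\<open>subst t s k\<close> replaces the variable \<open>k\<close> in \<open>t\<close> by \<open>s\<close> and removes \<open>k\<close> from the environment.\<close>

primrec subst :: "'a tm \<Rightarrow> 'a tm \<Rightarrow> nat \<Rightarrow> 'a tm" where
  "subst (Var i) s k = (if i < k then Var i else if i = k then s else Var (i - 1))"
| "subst (App t u) s k = App (subst t s k) (subst u s k)"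
| "subst (Lam \<sigma> t) s k = Lam \<sigma> (subst t (lift s 0) (Suc k))"

inductive typing :: "'a ty list \<Rightarrow> 'a tm \<Rightarrow> 'a ty \<Rightarrow> bool"
  (\<open>(_ \<turnstile> _ : _)\<close> [50, 50, 50] 50) where
  ty_Var: "i < length E \<Longrightarrow> E \<turnstile> Var i : E ! i"
| ty_App: "E \<turnstile> s : \<sigma> \<rightarrow>\<^sub>t \<tau> \<Longrightarrow> E \<turnstile> t : \<sigma> \<Longrightarrow> E \<turnstile> App s t : \<tau>"
| ty_Lam: "\<sigma> # E \<turnstile> t : \<tau> \<Longrightarrow> E \<turnstile> Lam \<sigma> t : \<sigma> \<rightarrow>\<^sub>t \<tau>"

text \<open>\<open>\<beta>\<eta>\<close>-equality is the congruence generated by \<open>\<beta>\<close> and \<open>\<eta>\<close> on well-typed terms of the same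
  type. The typing premises are essential: on raw annotated terms
  \<open>Lam \<sigma> (App (Lam \<tau> (Var 0)) (Var 0))\<close> is \<open>\<beta>\<close>-convertible to \<open>Lam \<sigma> (Var 0)\<close> and
  \<open>\<eta>\<close>-convertible to \<open>Lam \<tau> (Var 0)\<close>.\<close>

inductive beta_eta :: "'a ty list \<Rightarrow> 'a tm \<Rightarrow> 'a tm \<Rightarrow> 'a ty \<Rightarrow> bool"
  (\<open>(_ \<turnstile> _ =\<^sub>\<beta>\<^sub>\<eta> _ : _)\<close> [50, 50, 50, 50] 50) where
  be_beta: "\<sigma> # E \<turnstile> t : \<tau> \<Longrightarrow> E \<turnstile> s : \<sigma> \<Longrightarrow> E \<turnstile> App (Lam \<sigma> t) s =\<^sub>\<beta>\<^sub>\<eta> subst t s 0 : \<tau>"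
| be_eta: "E \<turnstile> t : \<sigma> \<rightarrow>\<^sub>t \<tau> \<Longrightarrow> E \<turnstile> Lam \<sigma> (App (lift t 0) (Var 0)) =\<^sub>\<beta>\<^sub>\<eta> t : \<sigma> \<rightarrow>\<^sub>t \<tau>"
| be_refl: "E \<turnstile> t : \<tau> \<Longrightarrow> E \<turnstile> t =\<^sub>\<beta>\<^sub>\<eta> t : \<tau>"
| be_sym: "E \<turnstile> s =\<^sub>\<beta>\<^sub>\<eta> t : \<tau> \<Longrightarrow> E \<turnstile> t =\<^sub>\<beta>\<^sub>\<eta> s : \<tau>"
| be_trans: "E \<turnstile> s =\<^sub>\<beta>\<^sub>\<eta> t : \<tau> \<Longrightarrow> E \<turnstile> t =\<^sub>\<beta>\<^sub>\<eta> u : \<tau> \<Longrightarrow> E \<turnstile> s =\<^sub>\<beta>\<^sub>\<eta> u : \<tau>"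
| be_App: "E \<turnstile> s =\<^sub>\<beta>\<^sub>\<eta> s' : \<sigma> \<rightarrow>\<^sub>t \<tau> \<Longrightarrow> E \<turnstile> t =\<^sub>\<beta>\<^sub>\<eta> t' : \<sigma> \<Longrightarrow> E \<turnstile> App s t =\<^sub>\<beta>\<^sub>\<eta> App s' t' : \<tau>"
| be_Lam: "\<sigma> # E \<turnstile> t =\<^sub>\<beta>\<^sub>\<eta> t' : \<tau> \<Longrightarrow> E \<turnstile> Lam \<sigma> t =\<^sub>\<beta>\<^sub>\<eta> Lam \<sigma> t' : \<sigma> \<rightarrow>\<^sub>t \<tau>"

section \<open>Retractions\<close>

text \<open>The variable \<open>x : \<rho>\<close> is index \<open>0\<close> of the environment \<open>\<rho> # E\<close>. The decoder \<open>D\<close> is typed in \<open>E\<close>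
  and lifted into \<open>\<rho> # E\<close>, so \<open>x\<close> is not free in it.\<close>

definition retract :: "'a ty \<Rightarrow> 'a ty \<Rightarrow> bool" (infix \<open>\<unlhd>\<close> 50) where
  "\<rho> \<unlhd> \<tau> \<longleftrightarrow> (\<exists>E C D.
     (\<rho> # E \<turnstile> C : \<tau>) \<and> (E \<turnstile> D : \<tau> \<rightarrow>\<^sub>t \<rho>) \<and>
     (\<rho> # E \<turnstile> App (lift D 0) C =\<^sub>\<beta>\<^sub>\<eta> Var 0 : \<rho>))"

end

(* Let C be the coder, D the decoder and x_1, ..., x_l fresh arguments, so that D C x_1 ... x_l
   equals x x_1 ... x_l. In the reduction, which takes place at the atomic type a = head rho, control
   alternates between D and a normal form of C, and every variable bound in C whose scope is entered
   has a part of tau under a path a^k with k odd as its type. At the moment when x comes to the head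
   of a subterm x R_1 ... R_l of C, the substitution accumulated so far turns R_i into x_i, although
   x_i does not occur in R_i; hence rho_i is a retract of the type of a single variable of R_i that
   is bound in C (lemma retract_component). The reduction itself is not traced: a unary logical
   predicate takes its place. Existence of normal forms and injectivity of neutral spines
   come from a Kripke logical relation over type-directed normalization. *)

theory Submission
  imports Defs
begin

section \<open>Parallel substitution\<close>

text \<open>The predicate \<open>reducible\<close> asserts at the atom \<open>a\<close> only that
  convertibility to the target spine, \<open>x\<close> applied to the fresh variables, entails a
  proposition \<open>G\<close>; in the end \<open>G\<close> is the conclusion of the theorem. A
  spine headed by any other variable can never be the target, so such variables are reducible and
  the decoder is covered by the fundamental lemma alone. The variable \<open>x\<close> is the single
  exception, and it is where \<open>G\<close> has to be earned. Terms of a type whose head is not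
  \<open>a\<close> are reducible for free. This confines the argument to paths with one repeated
  letter, and it also gives the equality of heads: if head(\<rho>) and head(\<tau>) differed, the
  coder would be reducible without any analysis, and \<open>G\<close>, which contains the equality,
  would follow. The obstacle is the typed, extensional equality. Two convertible spines can be
  compared only through normal forms that are computed along their types.\<close>

definition up :: "(nat \<Rightarrow> 'a tm) \<Rightarrow> nat \<Rightarrow> 'a tm" where
  "up \<theta> i = (case i of 0 \<Rightarrow> Var 0 | Suc j \<Rightarrow> lift (\<theta> j) 0)"

primrec sub :: "(nat \<Rightarrow> 'a tm) \<Rightarrow> 'a tm \<Rightarrow> 'a tm" where
  "sub \<theta> (Var i) = \<theta> i"
| "sub \<theta> (App s t) = App (sub \<theta> s) (sub \<theta> t)"
| "sub \<theta> (Lam \<sigma> t) = Lam \<sigma> (sub (up \<theta>) t)"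

abbreviation ren :: "(nat \<Rightarrow> nat) \<Rightarrow> 'a tm \<Rightarrow> 'a tm" where
  "ren r \<equiv> sub (\<lambda>i. Var (r i))"

primrec scons :: "'a tm \<Rightarrow> (nat \<Rightarrow> 'a tm) \<Rightarrow> nat \<Rightarrow> 'a tm" where
  "scons s \<theta> 0 = s"
| "scons s \<theta> (Suc i) = \<theta> i"

lemma scons_case: "scons s \<theta> i = (case i of 0 \<Rightarrow> s | Suc j \<Rightarrow> \<theta> j)"
  by (cases i) simp_all

abbreviation upr :: "(nat \<Rightarrow> nat) \<Rightarrow> nat \<Rightarrow> nat" where
  "upr r \<equiv> case_nat 0 (\<lambda>i. Suc (r i))"

lemma up_ren: "up (\<lambda>i. Var (r i)) = (\<lambda>i. Var (upr r i))"
  by (auto simp: up_def fun_eq_iff split: nat.splits)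

lemma lift_eq_ren: "lift t k = ren (\<lambda>i. if i < k then i else Suc i) t"
proof (induction t arbitrary: k)
  case (Lam \<sigma> t)
  have "upr (\<lambda>i. if i < k then i else Suc i) = (\<lambda>i. if i < Suc k then i else Suc i)"
    by (auto simp: fun_eq_iff split: nat.splits)
  then show ?case using Lam by (simp add: up_ren)
qed simp_all

lemma lift0: "lift t 0 = ren Suc t"
  by (simp add: lift_eq_ren)

lemma up_Var: "up Var = Var"
  by (auto simp: up_def fun_eq_iff split: nat.splits)

lemma sub_Var [simp]: "sub Var t = t"
  by (induction t) (simp_all add: up_Var)

text \<open>Composition is established in stages. Under a binder \<open>up\<close> itself renames,
  so each general law rests on the same law with a renaming on one side.\<close>

lemma sub_ren: "sub \<theta> (ren r t) = sub (\<lambda>i. \<theta> (r i)) t"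
proof (induction t arbitrary: \<theta> r)
  case (Lam \<sigma> t)
  have "(\<lambda>i. up \<theta> (upr r i)) = up (\<lambda>i. \<theta> (r i))"
    by (auto simp: up_def fun_eq_iff split: nat.splits)
  then show ?case by (simp add: up_ren Lam)
qed simp_all

lemma ren_sub: "ren r (sub \<theta> t) = sub (\<lambda>i. ren r (\<theta> i)) t"
proof (induction t arbitrary: \<theta> r)
  case (Lam \<sigma> t)
  have "(\<lambda>i. ren (upr r) (up \<theta> i)) = up (\<lambda>i. ren r (\<theta> i))"
    by (auto simp: up_def fun_eq_iff lift0 sub_ren split: nat.splits)
  then show ?case by (simp add: up_ren Lam)
qed simp_all

lemma sub_sub: "sub \<theta>' (sub \<theta> t) = sub (\<lambda>i. sub \<theta>' (\<theta> i)) t"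
proof (induction t arbitrary: \<theta> \<theta>')
  case (Lam \<sigma> t)
  have "(\<lambda>i. sub (up \<theta>') (up \<theta> i)) = up (\<lambda>i. sub \<theta>' (\<theta> i))"
    by (auto simp: up_def fun_eq_iff lift0 sub_ren ren_sub split: nat.splits)
  then show ?case by (simp add: Lam)
qed simp_all

lemma sub_up_lift: "sub (up \<theta>) (lift t 0) = lift (sub \<theta> t) 0"
  by (simp add: lift0 sub_sub up_def)

lemma sub_scons_lift [simp]: "sub (scons s \<theta>) (lift t 0) = sub \<theta> t"
  by (simp add: lift0 sub_sub)

lemma sub_scons_up: "sub (scons s \<theta>') (up \<theta> i) = scons s (\<lambda>j. sub \<theta>' (\<theta> j)) i"
  by (simp add: up_def scons_case split: nat.split)

lemma subst_eq_sub: "subst t s k = sub (\<lambda>i. if i < k then Var i else if i = k then s else Var (i - 1)) t"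
proof (induction t arbitrary: s k)
  case (Lam \<sigma> t)
  have "up (\<lambda>i. if i < k then Var i else if i = k then s else Var (i - 1)) =
     (\<lambda>i. if i < Suc k then Var i else if i = Suc k then lift s 0 else Var (i - 1))"
    by (auto simp: up_def fun_eq_iff split: nat.splits)
  then show ?case using Lam by simp
qed simp_all

lemma subst0: "subst t s 0 = sub (scons s Var) t"
proof -
  have "(\<lambda>i. if i < 0 then Var i else if i = 0 then s else Var (i - 1)) = scons s Var"
    by (auto simp: scons_case fun_eq_iff split: nat.splits)
  then show ?thesis by (simp add: subst_eq_sub)
qed

lemma subst0_sub_up: "subst (sub (up \<theta>) t) s 0 = sub (scons s \<theta>) t"
proof -
  have "(\<lambda>i. sub (scons s Var) (up \<theta> i)) = scons s \<theta>"
    by (simp add: fun_eq_iff sub_scons_up)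
  then show ?thesis by (simp add: subst0 sub_sub)
qed

lemma sub_subst0: "sub \<theta> (subst t s 0) = sub (scons (sub \<theta> s) \<theta>) t"
proof -
  have "(\<lambda>i. sub \<theta> (scons s Var i)) = scons (sub \<theta> s) \<theta>"
    by (auto simp: scons_case fun_eq_iff split: nat.splits)
  then show ?thesis by (simp add: subst0 sub_sub)
qed

section \<open>Typed substitutions\<close>

definition sub_typed :: "'a ty list \<Rightarrow> 'a ty list \<Rightarrow> (nat \<Rightarrow> 'a tm) \<Rightarrow> bool" where
  "sub_typed \<Gamma> \<Delta> \<theta> \<longleftrightarrow> (\<forall>i < length \<Gamma>. \<Delta> \<turnstile> \<theta> i : \<Gamma> ! i)"

definition ren_typed :: "'a ty list \<Rightarrow> 'a ty list \<Rightarrow> (nat \<Rightarrow> nat) \<Rightarrow> bool" where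
  "ren_typed \<Gamma> \<Delta> r \<longleftrightarrow> (\<forall>i < length \<Gamma>. r i < length \<Delta> \<and> \<Delta> ! r i = \<Gamma> ! i)"

inductive_cases typing_VarE: "\<Gamma> \<turnstile> Var i : \<tau>"
inductive_cases typing_AppE: "\<Gamma> \<turnstile> App s t : \<tau>"
inductive_cases typing_LamE: "\<Gamma> \<turnstile> Lam \<sigma> t : \<tau>"

lemma ty_Var': "i < length \<Gamma> \<Longrightarrow> \<Gamma> ! i = \<sigma> \<Longrightarrow> \<Gamma> \<turnstile> Var i : \<sigma>"
  using ty_Var by blast

lemma ren_typed_upr: "ren_typed \<Gamma> \<Delta> r \<Longrightarrow> ren_typed (\<sigma> # \<Gamma>) (\<sigma> # \<Delta>) (upr r)"
  by (auto simp: ren_typed_def nth_Cons split: nat.splits)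

lemma ren_typed_Suc: "ren_typed \<Gamma> (\<sigma> # \<Gamma>) Suc"
  by (auto simp: ren_typed_def)

lemma ren_typed_comp:
  "ren_typed \<Gamma> \<Delta> r \<Longrightarrow> ren_typed \<Delta> \<Theta> r' \<Longrightarrow> ren_typed \<Gamma> \<Theta> (\<lambda>i. r' (r i))"
  by (auto simp: ren_typed_def)

lemma typing_ren: "\<Gamma> \<turnstile> t : \<tau> \<Longrightarrow> ren_typed \<Gamma> \<Delta> r \<Longrightarrow> \<Delta> \<turnstile> ren r t : \<tau>"
proof (induction arbitrary: \<Delta> r rule: typing.induct)
  case (ty_Var i E)
  then show ?case by (auto simp: ren_typed_def intro: ty_Var')
next
  case (ty_App E s \<sigma> \<tau> t)
  then show ?case by simp (blast intro: typing.ty_App)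
next
  case (ty_Lam \<sigma> E t \<tau>)
  then show ?case by (auto simp: up_ren intro!: typing.ty_Lam ren_typed_upr)
qed

lemma typing_lift: "\<Gamma> \<turnstile> t : \<tau> \<Longrightarrow> \<sigma> # \<Gamma> \<turnstile> lift t 0 : \<tau>"
  by (simp add: lift0 typing_ren ren_typed_Suc)

lemma sub_typed_ren: "ren_typed \<Gamma> \<Delta> r \<Longrightarrow> sub_typed \<Gamma> \<Delta> (\<lambda>i. Var (r i))"
  by (auto simp: ren_typed_def sub_typed_def intro: ty_Var')

lemma sub_typed_up:
  assumes "sub_typed \<Gamma> \<Delta> \<theta>"
  shows "sub_typed (\<sigma> # \<Gamma>) (\<sigma> # \<Delta>) (up \<theta>)"
  unfolding sub_typed_def
proof (intro allI impI)
  fix i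
  assume "i < length (\<sigma> # \<Gamma>)"
  then show "\<sigma> # \<Delta> \<turnstile> up \<theta> i : (\<sigma> # \<Gamma>) ! i"
    using assms by (cases i) (simp_all add: sub_typed_def up_def typing_lift ty_Var')
qed

lemma sub_typed_scons:
  "\<Delta> \<turnstile> s : \<sigma> \<Longrightarrow> sub_typed \<Gamma> \<Delta> \<theta> \<Longrightarrow> sub_typed (\<sigma> # \<Gamma>) \<Delta> (scons s \<theta>)"
  by (auto simp: scons_case sub_typed_def nth_Cons split: nat.splits)

lemma sub_typed_Var: "sub_typed \<Gamma> \<Gamma> Var"
  by (auto simp: sub_typed_def intro: ty_Var')

lemma typing_sub: "\<Gamma> \<turnstile> t : \<tau> \<Longrightarrow> sub_typed \<Gamma> \<Delta> \<theta> \<Longrightarrow> \<Delta> \<turnstile> sub \<theta> t : \<tau>"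
proof (induction arbitrary: \<Delta> \<theta> rule: typing.induct)
  case (ty_Var i E)
  then show ?case by (auto simp: sub_typed_def)
next
  case (ty_App E s \<sigma> \<tau> t)
  then show ?case by simp (blast intro: typing.ty_App)
next
  case (ty_Lam \<sigma> E t \<tau>)
  then show ?case by (auto intro!: typing.ty_Lam sub_typed_up)
qed

lemma typing_subst0: "\<sigma> # \<Gamma> \<turnstile> t : \<tau> \<Longrightarrow> \<Gamma> \<turnstile> s : \<sigma> \<Longrightarrow> \<Gamma> \<turnstile> subst t s 0 : \<tau>"
  unfolding subst0 by (rule typing_sub[OF _ sub_typed_scons]) (auto intro: sub_typed_Var)

lemma sub_cong:
  "\<Gamma> \<turnstile> t : \<tau> \<Longrightarrow> (\<And>i. i < length \<Gamma> \<Longrightarrow> \<theta> i = \<theta>' i) \<Longrightarrow> sub \<theta> t = sub \<theta>' t"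
proof (induction arbitrary: \<theta> \<theta>' rule: typing.induct)
  case (ty_Lam \<sigma> E t \<tau>)
  have "sub (up \<theta>) t = sub (up \<theta>') t"
    by (rule ty_Lam.IH) (auto simp: up_def ty_Lam.prems split: nat.splits)
  then show ?case by simp
next
  case (ty_App E s \<sigma> \<tau> t)
  have "sub \<theta> s = sub \<theta>' s" "sub \<theta> t = sub \<theta>' t"
    by (rule ty_App.IH; use ty_App.prems in blast)+
  then show ?case by simp
qed simp

lemma typing_eta_body:
  assumes "\<Gamma> \<turnstile> t : \<sigma> \<rightarrow>\<^sub>t \<tau>"
  shows "\<sigma> # \<Gamma> \<turnstile> App (lift t 0) (Var 0) : \<tau>"
  by (rule ty_App[OF typing_lift[OF assms]]) (simp add: ty_Var')

section \<open>Conversion: typing, substitution, extensionality\<close>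

lemma be_typed: "\<Gamma> \<turnstile> s =\<^sub>\<beta>\<^sub>\<eta> t : \<tau> \<Longrightarrow> \<Gamma> \<turnstile> s : \<tau> \<and> \<Gamma> \<turnstile> t : \<tau>"
proof (induction rule: beta_eta.induct)
  case (be_beta \<sigma> E t \<tau> s)
  then show ?case by (blast intro: ty_App ty_Lam typing_subst0)
next
  case (be_eta E t \<sigma> \<tau>)
  then show ?case by (blast intro: ty_Lam typing_eta_body)
next
  case (be_App E s s' \<sigma> \<tau> t t')
  then show ?case by (blast intro: ty_App)
next
  case (be_Lam \<sigma> E t t' \<tau>)
  then show ?case by (blast intro: ty_Lam)
qed blast+

lemma be_sub: "\<Gamma> \<turnstile> s =\<^sub>\<beta>\<^sub>\<eta> t : \<tau> \<Longrightarrow> sub_typed \<Gamma> \<Delta> \<theta> \<Longrightarrow> \<Delta> \<turnstile> sub \<theta> s =\<^sub>\<beta>\<^sub>\<eta> sub \<theta> t : \<tau>"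
proof (induction arbitrary: \<Delta> \<theta> rule: beta_eta.induct)
  case (be_beta \<sigma> E t \<tau> s)
  have "\<Delta> \<turnstile> App (Lam \<sigma> (sub (up \<theta>) t)) (sub \<theta> s) =\<^sub>\<beta>\<^sub>\<eta> subst (sub (up \<theta>) t) (sub \<theta> s) 0 : \<tau>"
    using be_beta by (blast intro: beta_eta.be_beta typing_sub sub_typed_up)
  then show ?case by (simp add: subst0_sub_up sub_subst0)
next
  case (be_eta E t \<sigma> \<tau>)
  then show ?case by (auto simp: sub_up_lift up_def intro: beta_eta.be_eta typing_sub)
next
  case (be_refl E t \<tau>)
  then show ?case by (blast intro: beta_eta.be_refl typing_sub)
next
  case (be_App E s s' \<sigma> \<tau> t t')
  then show ?case by simp (blast intro: beta_eta.be_App)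
next
  case (be_Lam \<sigma> E t t' \<tau>)
  then show ?case by (auto intro: beta_eta.be_Lam sub_typed_up)
qed (blast intro: beta_eta.intros)+

lemma be_ren: "\<Gamma> \<turnstile> s =\<^sub>\<beta>\<^sub>\<eta> t : \<tau> \<Longrightarrow> ren_typed \<Gamma> \<Delta> r \<Longrightarrow> \<Delta> \<turnstile> ren r s =\<^sub>\<beta>\<^sub>\<eta> ren r t : \<tau>"
  by (rule be_sub[OF _ sub_typed_ren])

lemma be_extI:
  assumes s: "\<Gamma> \<turnstile> s : \<sigma> \<rightarrow>\<^sub>t \<tau>" and t: "\<Gamma> \<turnstile> t : \<sigma> \<rightarrow>\<^sub>t \<tau>"
    and eq: "\<sigma> # \<Gamma> \<turnstile> App (lift s 0) (Var 0) =\<^sub>\<beta>\<^sub>\<eta> App (lift t 0) (Var 0) : \<tau>"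
  shows "\<Gamma> \<turnstile> s =\<^sub>\<beta>\<^sub>\<eta> t : \<sigma> \<rightarrow>\<^sub>t \<tau>"
  by (meson be_Lam[OF eq] be_eta[OF s] be_eta[OF t] be_sym be_trans)

section \<open>Type-directed normalization\<close>

inductive whr :: "'a tm \<Rightarrow> 'a tm \<Rightarrow> bool" (infix \<open>\<leadsto>\<close> 50) where
  whr_beta: "App (Lam \<sigma> t) s \<leadsto> subst t s 0"
| whr_App: "s \<leadsto> s' \<Longrightarrow> App s t \<leadsto> App s' t"

text \<open>Computation of \<eta>-long \<beta>-normal forms: the first term is the input, the second
  the output. \<open>nf\<close> is directed by a given type and \<eta>-expands at every arrow, while
  \<open>ne\<close> synthesizes the type of a neutral term from its head variable.\<close>

inductive nf :: "'a ty list \<Rightarrow> 'a tm \<Rightarrow> 'a tm \<Rightarrow> 'a ty \<Rightarrow> bool"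
  and ne :: "'a ty list \<Rightarrow> 'a tm \<Rightarrow> 'a tm \<Rightarrow> 'a ty \<Rightarrow> bool" where
  nf_Fun: "nf (\<sigma> # \<Gamma>) (App (lift s 0) (Var 0)) n \<tau> \<Longrightarrow> nf \<Gamma> s (Lam \<sigma> n) (\<sigma> \<rightarrow>\<^sub>t \<tau>)"
| nf_whr: "s \<leadsto> s' \<Longrightarrow> nf \<Gamma> s' n (Atom a) \<Longrightarrow> nf \<Gamma> s n (Atom a)"
| nf_ne: "ne \<Gamma> p n (Atom a) \<Longrightarrow> nf \<Gamma> p n (Atom a)"
| ne_Var: "i < length \<Gamma> \<Longrightarrow> ne \<Gamma> (Var i) (Var i) (\<Gamma> ! i)"
| ne_App: "ne \<Gamma> p m (\<sigma> \<rightarrow>\<^sub>t \<tau>) \<Longrightarrow> nf \<Gamma> s n \<sigma> \<Longrightarrow> ne \<Gamma> (App p s) (App m n) \<tau>"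

inductive_cases whr_VarE: "Var i \<leadsto> t"
inductive_cases whr_LamE: "Lam \<sigma> s \<leadsto> t"
inductive_cases whr_AppE: "App s s' \<leadsto> t"
inductive_cases nf_FunE: "nf \<Gamma> s n (\<sigma> \<rightarrow>\<^sub>t \<tau>)"
inductive_cases nf_AtomE: "nf \<Gamma> s n (Atom a)"
inductive_cases ne_VarE: "ne \<Gamma> (Var i) n \<tau>"
inductive_cases ne_AppE: "ne \<Gamma> (App p s) n \<tau>"
inductive_cases ne_LamE: "ne \<Gamma> (Lam \<sigma> s) n \<tau>"

section \<open>Determinism, stability under renaming and soundness of normalization\<close>

lemma whr_sub: "s \<leadsto> t \<Longrightarrow> sub \<theta> s \<leadsto> sub \<theta> t"
proof (induction rule: whr.induct)
  case (whr_beta \<sigma> t s)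
  show ?case
    using whr.whr_beta[of \<sigma> "sub (up \<theta>) t" "sub \<theta> s"] by (simp add: subst0_sub_up sub_subst0)
qed (auto intro: whr.intros)

lemma whr_det: "s \<leadsto> t \<Longrightarrow> s \<leadsto> t' \<Longrightarrow> t = t'"
proof (induction arbitrary: t' rule: whr.induct)
  case (whr_beta \<sigma> t s)
  then show ?case by (blast elim: whr_AppE whr_LamE)
next
  case (whr_App s s' t)
  from whr_App.prems show ?case
    using whr_App.hyps whr_App.IH by (cases rule: whr.cases) (blast elim: whr_LamE)+
qed

lemma whr_be: "s \<leadsto> t \<Longrightarrow> \<Gamma> \<turnstile> s : \<tau> \<Longrightarrow> \<Gamma> \<turnstile> s =\<^sub>\<beta>\<^sub>\<eta> t : \<tau>"
proof (induction arbitrary: \<tau> rule: whr.induct)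
  case (whr_beta \<sigma> t s)
  then show ?case by (auto elim!: typing_AppE typing_LamE intro: be_beta)
next
  case (whr_App s s' t)
  then show ?case by (auto elim!: typing_AppE intro: be_App be_refl)
qed

lemma ne_not_whr: "s \<leadsto> t \<Longrightarrow> \<not> ne \<Gamma> s n \<tau>"
  by (induction arbitrary: n \<tau> rule: whr.induct) (auto elim: ne_AppE ne_LamE)

text \<open>The two rules at an atom exclude each other because neutral terms have no weak head
  step. For \<open>ne\<close> the type must be determined as well: an application does not record
  the type of its argument, at which the argument is normalized.\<close>

lemma nf_det:
  "nf \<Gamma> s n \<tau> \<Longrightarrow> nf \<Gamma> s n' \<tau> \<Longrightarrow> n = n'"
  "ne \<Gamma> s n \<tau> \<Longrightarrow> ne \<Gamma> s n' \<tau>' \<Longrightarrow> n = n' \<and> \<tau> = \<tau>'"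
proof (induction arbitrary: n' and n' \<tau>' rule: nf_ne.inducts)
  case (nf_Fun \<sigma> \<Gamma> s n \<tau>)
  then show ?case by (blast elim: nf_FunE)
next
  case (nf_whr s s' \<Gamma> n a)
  from nf_whr.prems show ?case
  proof (rule nf_AtomE)
    fix s'' assume "s \<leadsto> s''" "nf \<Gamma> s'' n' (Atom a)"
    then show ?thesis using nf_whr.IH nf_whr.hyps whr_det by blast
  next
    assume "ne \<Gamma> s n' (Atom a)"
    then show ?thesis using nf_whr.hyps ne_not_whr by blast
  qed
next
  case (nf_ne \<Gamma> p n a)
  from nf_ne.prems show ?case
  proof (rule nf_AtomE)
    fix p' assume "p \<leadsto> p'"
    then show ?thesis using nf_ne.hyps ne_not_whr by blast
  next
    assume "ne \<Gamma> p n' (Atom a)"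
    then show ?thesis using nf_ne.IH by blast
  qed
next
  case (ne_Var i \<Gamma>)
  then show ?case by (blast elim: ne_VarE)
next
  case (ne_App \<Gamma> p m \<sigma> \<tau> s n)
  from ne_App.prems obtain m' \<sigma>' k where
    "n' = App m' k" "ne \<Gamma> p m' (\<sigma>' \<rightarrow>\<^sub>t \<tau>')" "nf \<Gamma> s k \<sigma>'"
    by (blast elim: ne_AppE)
  moreover have "m = m'" "\<sigma> \<rightarrow>\<^sub>t \<tau> = \<sigma>' \<rightarrow>\<^sub>t \<tau>'"
    using ne_App.IH(1) calculation(2) by blast+
  ultimately show ?case using ne_App.IH(2) by blast
qed

lemma nf_ren:
  "nf \<Gamma> s n \<tau> \<Longrightarrow> ren_typed \<Gamma> \<Delta> r \<Longrightarrow> nf \<Delta> (ren r s) (ren r n) \<tau>"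
  "ne \<Gamma> s n \<tau> \<Longrightarrow> ren_typed \<Gamma> \<Delta> r \<Longrightarrow> ne \<Delta> (ren r s) (ren r n) \<tau>"
proof (induction arbitrary: \<Delta> r and \<Delta> r rule: nf_ne.inducts)
  case (nf_Fun \<sigma> \<Gamma> s n \<tau>)
  have "nf (\<sigma> # \<Delta>) (ren (upr r) (App (lift s 0) (Var 0))) (ren (upr r) n) \<tau>"
    by (intro nf_Fun ren_typed_upr)
  moreover have "ren (upr r) (lift s 0) = lift (ren r s) 0"
    using sub_up_lift[of "\<lambda>i. Var (r i)" s] by (simp add: up_ren)
  ultimately show ?case by (auto simp: up_ren intro: nf_ne.nf_Fun)
next
  case (nf_whr s s' \<Gamma> n a)
  then show ?case by (blast intro: nf_ne.nf_whr whr_sub)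
next
  case (ne_Var i \<Gamma>)
  then show ?case using nf_ne.ne_Var[of "r i" \<Delta>] by (simp add: ren_typed_def)
next
  case (nf_ne \<Gamma> p n a)
  then show ?case by (blast intro: nf_ne.nf_ne)
next
  case (ne_App \<Gamma> p m \<sigma> \<tau> s n)
  then show ?case by simp (blast intro: nf_ne.ne_App)
qed

lemma nf_be:
  "nf \<Gamma> s n \<tau> \<Longrightarrow> \<Gamma> \<turnstile> s : \<tau> \<Longrightarrow> \<Gamma> \<turnstile> s =\<^sub>\<beta>\<^sub>\<eta> n : \<tau>"
  "ne \<Gamma> s n \<tau> \<Longrightarrow> \<Gamma> \<turnstile> s : \<tau>' \<Longrightarrow> \<tau>' = \<tau> \<and> \<Gamma> \<turnstile> s =\<^sub>\<beta>\<^sub>\<eta> n : \<tau>"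
proof (induction arbitrary: and \<tau>' rule: nf_ne.inducts)
  case (nf_Fun \<sigma> \<Gamma> s n \<tau>)
  have "\<sigma> # \<Gamma> \<turnstile> App (lift s 0) (Var 0) : \<tau>"
    using nf_Fun.prems by (rule typing_eta_body)
  then have "\<Gamma> \<turnstile> Lam \<sigma> (App (lift s 0) (Var 0)) =\<^sub>\<beta>\<^sub>\<eta> Lam \<sigma> n : \<sigma> \<rightarrow>\<^sub>t \<tau>"
    by (intro be_Lam nf_Fun.IH)
  then show ?case using be_eta[OF nf_Fun.prems] by (meson be_sym be_trans)
next
  case (nf_whr s s' \<Gamma> n a)
  have "\<Gamma> \<turnstile> s =\<^sub>\<beta>\<^sub>\<eta> s' : Atom a" using nf_whr by (blast intro: whr_be)
  then show ?case using nf_whr.IH be_typed be_trans by blast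
next
  case (ne_Var i \<Gamma>)
  then show ?case by (auto elim: typing_VarE intro: be_refl)
next
  case (ne_App \<Gamma> p m \<sigma> \<tau> s n)
  from ne_App.prems obtain \<sigma>' where "\<Gamma> \<turnstile> p : \<sigma>' \<rightarrow>\<^sub>t \<tau>'" "\<Gamma> \<turnstile> s : \<sigma>'"
    by (blast elim: typing_AppE)
  with ne_App.IH(1) ne_App.IH(2) show ?case by (blast intro: be_App)
qed blast

section \<open>A Kripke logical relation\<close>

text \<open>The worlds are environments, ordered by typed renamings. Reification forces this Kripke
  form: it applies a function to a fresh variable, which exists only in a larger
  environment.\<close>

primrec LR :: "'a ty \<Rightarrow> 'a ty list \<Rightarrow> 'a tm \<Rightarrow> 'a tm \<Rightarrow> bool" where
  "LR (Atom a) \<Gamma> s t \<longleftrightarrow> (\<exists>n. nf \<Gamma> s n (Atom a) \<and> nf \<Gamma> t n (Atom a))"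
| "LR (\<sigma> \<rightarrow>\<^sub>t \<tau>) \<Gamma> s t \<longleftrightarrow> (\<forall>\<Delta> r s' t'. ren_typed \<Gamma> \<Delta> r \<longrightarrow> LR \<sigma> \<Delta> s' t' \<longrightarrow>
     LR \<tau> \<Delta> (App (ren r s) s') (App (ren r t) t'))"

lemma LR_ren: "LR \<tau> \<Gamma> s t \<Longrightarrow> ren_typed \<Gamma> \<Delta> r \<Longrightarrow> LR \<tau> \<Delta> (ren r s) (ren r t)"
proof (cases \<tau>)
  case (Atom a)
  assume "LR \<tau> \<Gamma> s t" "ren_typed \<Gamma> \<Delta> r"
  then show ?thesis using Atom by (auto dest: nf_ren(1))
next
  case (Fun \<sigma> \<tau>')
  assume LR: "LR \<tau> \<Gamma> s t" and r: "ren_typed \<Gamma> \<Delta> r"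
  show ?thesis unfolding Fun LR.simps
  proof (intro allI impI)
    fix \<Delta>' r' s' t'
    assume "ren_typed \<Delta> \<Delta>' r'" "LR \<sigma> \<Delta>' s' t'"
    then show "LR \<tau>' \<Delta>' (App (ren r' (ren r s)) s') (App (ren r' (ren r t)) t')"
      using LR ren_typed_comp[OF r] unfolding Fun LR.simps by (simp add: sub_sub)
  qed
qed

lemma LR_sym: "LR \<tau> \<Gamma> s t \<Longrightarrow> LR \<tau> \<Gamma> t s"
  by (induction \<tau> arbitrary: \<Gamma> s t) auto

lemma LR_trans: "LR \<tau> \<Gamma> s t \<Longrightarrow> LR \<tau> \<Gamma> t u \<Longrightarrow> LR \<tau> \<Gamma> s u"
proof (induction \<tau> arbitrary: \<Gamma> s t u)
  case (Atom a)
  then obtain n n' where "nf \<Gamma> s n (Atom a)" "nf \<Gamma> t n (Atom a)" "nf \<Gamma> t n' (Atom a)"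
    "nf \<Gamma> u n' (Atom a)" by auto
  moreover from this(2,3) have "n = n'" by (rule nf_det(1))
  ultimately show ?case by auto
next
  case (Fun \<sigma> \<tau>)
  show ?case unfolding LR.simps
  proof (intro allI impI)
    fix \<Delta> r s' t'
    assume r: "ren_typed \<Gamma> \<Delta> r" and st: "LR \<sigma> \<Delta> s' t'"
    \<comment> \<open>The relation is a partial equivalence: anything related to something is
      related to itself. So \<open>t'\<close> can serve as the argument on both sides of the second
      link.\<close>
    have "LR \<sigma> \<Delta> t' t'" using st LR_sym Fun.IH(1) by blast
    with Fun.prems r st have "LR \<tau> \<Delta> (App (ren r s) s') (App (ren r t) t')"
      "LR \<tau> \<Delta> (App (ren r t) t') (App (ren r u) t')" by simp_all
    then show "LR \<tau> \<Delta> (App (ren r s) s') (App (ren r u) t')" by (rule Fun.IH(2))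
  qed
qed

lemma LR_whr: "s \<leadsto> s' \<Longrightarrow> LR \<tau> \<Gamma> s' t \<Longrightarrow> LR \<tau> \<Gamma> s t"
proof (induction \<tau> arbitrary: \<Gamma> s s' t)
  case (Atom a)
  then show ?case by (auto intro: nf_whr)
next
  case (Fun \<sigma> \<tau>)
  show ?case unfolding LR.simps
  proof (intro allI impI)
    fix \<Delta> r u u'
    assume "ren_typed \<Gamma> \<Delta> r" "LR \<sigma> \<Delta> u u'"
    then have "LR \<tau> \<Delta> (App (ren r s') u) (App (ren r t) u')"
      using Fun.prems(2) by simp
    then show "LR \<tau> \<Delta> (App (ren r s) u) (App (ren r t) u')"
      by (rule Fun.IH(2)[OF whr_App[OF whr_sub[OF Fun.prems(1)]]])
  qed
qed

text \<open>The two halves need each other because arrows are contravariant: reifying a function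
  reflects a fresh variable at the argument type, and reflecting a neutral function reifies its
  argument.\<close>

lemma LR_reify_reflect:
  "(LR \<tau> \<Gamma> s t \<longrightarrow> (\<exists>n. nf \<Gamma> s n \<tau> \<and> nf \<Gamma> t n \<tau>)) \<and>
   (ne \<Gamma> p m \<tau> \<and> ne \<Gamma> q m \<tau> \<longrightarrow> LR \<tau> \<Gamma> p q)"
proof (induction \<tau> arbitrary: \<Gamma> s t p q m)
  case (Atom a)
  then show ?case by (auto intro: nf_ne)
next
  case (Fun \<sigma> \<tau>)
  have "\<exists>n. nf \<Gamma> s n (\<sigma> \<rightarrow>\<^sub>t \<tau>) \<and> nf \<Gamma> t n (\<sigma> \<rightarrow>\<^sub>t \<tau>)" if "LR (\<sigma> \<rightarrow>\<^sub>t \<tau>) \<Gamma> s t"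
  proof -
    have "ne (\<sigma> # \<Gamma>) (Var 0) (Var 0) \<sigma>" using ne_Var[of 0 "\<sigma> # \<Gamma>"] by simp
    then have "LR \<sigma> (\<sigma> # \<Gamma>) (Var 0) (Var 0)" using Fun.IH(1) by blast
    then have "LR \<tau> (\<sigma> # \<Gamma>) (App (lift s 0) (Var 0)) (App (lift t 0) (Var 0))"
      using that ren_typed_Suc[of \<Gamma> \<sigma>] by (auto simp: lift0)
    then obtain n where "nf (\<sigma> # \<Gamma>) (App (lift s 0) (Var 0)) n \<tau>"
      "nf (\<sigma> # \<Gamma>) (App (lift t 0) (Var 0)) n \<tau>"
      using Fun.IH(2)[THEN conjunct1] by blast
    then show ?thesis by (blast intro: nf_Fun)
  qed
  moreover have "LR (\<sigma> \<rightarrow>\<^sub>t \<tau>) \<Gamma> p q" if "ne \<Gamma> p m (\<sigma> \<rightarrow>\<^sub>t \<tau>)" "ne \<Gamma> q m (\<sigma> \<rightarrow>\<^sub>t \<tau>)"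
    unfolding LR.simps
  proof (intro allI impI)
    fix \<Delta> r s' t'
    assume r: "ren_typed \<Gamma> \<Delta> r" and st: "LR \<sigma> \<Delta> s' t'"
    obtain n where "nf \<Delta> s' n \<sigma>" "nf \<Delta> t' n \<sigma>" using st Fun.IH(1) by blast
    then have "ne \<Delta> (App (ren r p) s') (App (ren r m) n) \<tau>"
      "ne \<Delta> (App (ren r q) t') (App (ren r m) n) \<tau>"
      using that r by (blast intro: nf_ren(2) ne_App)+
    then show "LR \<tau> \<Delta> (App (ren r p) s') (App (ren r q) t')"
      using Fun.IH(2)[THEN conjunct2] by blast
  qed
  ultimately show ?case by blast
qed

section \<open>The fundamental lemma and common normal forms\<close>

definition LR_sub where
  "LR_sub \<Gamma> \<Delta> \<theta> \<theta>' \<longleftrightarrow> (\<forall>i < length \<Gamma>. LR (\<Gamma> ! i) \<Delta> (\<theta> i) (\<theta>' i))"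

lemma LR_sub_scons:
  "LR \<sigma> \<Delta> s t \<Longrightarrow> LR_sub \<Gamma> \<Delta> \<theta> \<theta>' \<Longrightarrow> LR_sub (\<sigma> # \<Gamma>) \<Delta> (scons s \<theta>) (scons t \<theta>')"
  by (auto simp: scons_case LR_sub_def nth_Cons split: nat.splits)

lemma LR_sub_ren:
  "LR_sub \<Gamma> \<Delta> \<theta> \<theta>' \<Longrightarrow> ren_typed \<Delta> \<Delta>' r \<Longrightarrow>
   LR_sub \<Gamma> \<Delta>' (\<lambda>i. ren r (\<theta> i)) (\<lambda>i. ren r (\<theta>' i))"
  by (auto simp: LR_sub_def intro: LR_ren)

lemma whr_sub_Lam:
  "App (ren r (sub \<theta> (Lam \<sigma> t))) s \<leadsto> sub (scons s (\<lambda>i. ren r (\<theta> i))) t"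
  unfolding ren_sub by (simp add: whr_beta flip: subst0_sub_up)

lemma LR_Lam:
  assumes "\<And>\<Delta>' r s s'. ren_typed \<Delta> \<Delta>' r \<Longrightarrow> LR \<sigma> \<Delta>' s s' \<Longrightarrow>
    LR \<tau> \<Delta>' (sub (scons s (\<lambda>i. ren r (\<theta> i))) t) (sub (scons s' (\<lambda>i. ren r (\<theta>' i))) t')"
  shows "LR (\<sigma> \<rightarrow>\<^sub>t \<tau>) \<Delta> (sub \<theta> (Lam \<sigma> t)) (sub \<theta>' (Lam \<sigma> t'))"
  unfolding LR.simps
proof (intro allI impI)
  fix \<Delta>' r s s'
  assume "ren_typed \<Delta> \<Delta>' r" "LR \<sigma> \<Delta>' s s'"
  note * = assms[OF this]
  \<comment> \<open>\<open>LR_whr\<close> expands the left term only; symmetry moves each side there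
    in turn.\<close>
  show "LR \<tau> \<Delta>' (App (ren r (sub \<theta> (Lam \<sigma> t))) s) (App (ren r (sub \<theta>' (Lam \<sigma> t'))) s')"
    by (rule LR_whr[OF whr_sub_Lam], rule LR_sym, rule LR_whr[OF whr_sub_Lam], rule LR_sym) (rule *)
qed

lemma LR_App:
  "LR (\<sigma> \<rightarrow>\<^sub>t \<tau>) \<Gamma> s s' \<Longrightarrow> LR \<sigma> \<Gamma> t t' \<Longrightarrow> LR \<tau> \<Gamma> (App s t) (App s' t')"
proof -
  assume "LR (\<sigma> \<rightarrow>\<^sub>t \<tau>) \<Gamma> s s'" "LR \<sigma> \<Gamma> t t'"
  moreover have "ren_typed \<Gamma> \<Gamma> (\<lambda>i. i)" by (simp add: ren_typed_def)
  ultimately have "LR \<tau> \<Gamma> (App (ren (\<lambda>i. i) s) t) (App (ren (\<lambda>i. i) s') t')"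
    unfolding LR.simps by blast
  then show ?thesis by simp
qed

lemma LR_typing:
  "\<Gamma> \<turnstile> t : \<tau> \<Longrightarrow> LR_sub \<Gamma> \<Delta> \<theta> \<theta>' \<Longrightarrow> LR \<tau> \<Delta> (sub \<theta> t) (sub \<theta>' t)"
proof (induction arbitrary: \<Delta> \<theta> \<theta>' rule: typing.induct)
  case (ty_Var i E)
  then show ?case by (simp add: LR_sub_def)
next
  case (ty_App E s \<sigma> \<tau> t)
  then show ?case by (auto intro!: LR_App simp del: LR.simps)
next
  case (ty_Lam \<sigma> E t \<tau>)
  then show ?case by (intro LR_Lam) (blast intro: LR_sub_scons LR_sub_ren)
qed

lemma LR_be:
  "\<Gamma> \<turnstile> s =\<^sub>\<beta>\<^sub>\<eta> t : \<tau> \<Longrightarrow> LR_sub \<Gamma> \<Delta> \<theta> \<theta>' \<Longrightarrow> LR \<tau> \<Delta> (sub \<theta> s) (sub \<theta>' t)"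
proof (induction arbitrary: \<Delta> \<theta> \<theta>' rule: beta_eta.induct)
  case (be_beta \<sigma> E t \<tau> s)
  have "sub \<theta> (App (Lam \<sigma> t) s) \<leadsto> sub (scons (sub \<theta> s) \<theta>) t"
    by (simp add: whr_beta flip: subst0_sub_up)
  moreover have "LR \<tau> \<Delta> (sub (scons (sub \<theta> s) \<theta>) t) (sub (scons (sub \<theta>' s) \<theta>') t)"
    using be_beta by (blast intro: LR_typing LR_sub_scons)
  ultimately show ?case by (simp add: LR_whr sub_subst0)
next
  case (be_eta E t \<sigma> \<tau>)
  show ?case unfolding LR.simps
  proof (intro allI impI)
    fix \<Delta>' r s s'
    assume r: "ren_typed \<Delta> \<Delta>' r" and ss: "LR \<sigma> \<Delta>' s s'"
    have "App (ren r (sub \<theta> (Lam \<sigma> (App (lift t 0) (Var 0))))) s \<leadsto>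
        sub (scons s (\<lambda>i. ren r (\<theta> i))) (App (lift t 0) (Var 0))"
      by (rule whr_sub_Lam)
    moreover have "LR \<tau> \<Delta>' (App (ren r (sub \<theta> t)) s) (App (ren r (sub \<theta>' t)) s')"
      by (rule LR_App[OF LR_ren[OF LR_typing[OF be_eta.hyps be_eta.prems] r] ss])
    ultimately show "LR \<tau> \<Delta>' (App (ren r (sub \<theta> (Lam \<sigma> (App (lift t 0) (Var 0))))) s)
        (App (ren r (sub \<theta>' t)) s')"
      by (simp add: LR_whr ren_sub)
  qed
next
  case (be_refl E t \<tau>)
  then show ?case by (blast intro: LR_typing)
next
  case (be_sym E s t \<tau>)
  then have "LR_sub E \<Delta> \<theta>' \<theta>" by (simp add: LR_sub_def LR_sym)
  then show ?case using be_sym.IH LR_sym by blast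
next
  case (be_trans E s t \<tau> u)
  \<comment> \<open>The middle term must be related to the last one with the same substitution on
    both sides, so \<open>\<theta>'\<close> has to be related to itself.\<close>
  then have "LR_sub E \<Delta> \<theta>' \<theta>'" unfolding LR_sub_def by (blast intro: LR_sym LR_trans)
  then show ?case using be_trans LR_trans by blast
next
  case (be_App E s s' \<sigma> \<tau> t t')
  then show ?case by (auto intro!: LR_App simp del: LR.simps)
next
  case (be_Lam \<sigma> E t t' \<tau>)
  then show ?case by (intro LR_Lam) (blast intro: LR_sub_scons LR_sub_ren)
qed

text \<open>This takes the place of confluence. Variables are neutral, hence related to themselves
  by reflection, so the fundamental lemma applies to the identity substitution and reification
  yields one normal form for both terms.\<close>

theorem be_common_nf:
  assumes "\<Gamma> \<turnstile> s =\<^sub>\<beta>\<^sub>\<eta> t : \<tau>"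
  obtains n where "nf \<Gamma> s n \<tau>" "nf \<Gamma> t n \<tau>"
proof -
  have "LR_sub \<Gamma> \<Gamma> Var Var"
    using LR_reify_reflect ne_Var unfolding LR_sub_def by blast
  from LR_be[OF assms this] show ?thesis using LR_reify_reflect that by fastforce
qed


section \<open>Spines and long normal forms\<close>

abbreviation apps :: "'a tm \<Rightarrow> 'a tm list \<Rightarrow> 'a tm" where
  "apps t ts \<equiv> foldl App t ts"

abbreviation funs :: "'a ty list \<Rightarrow> 'a ty \<Rightarrow> 'a ty" where
  "funs \<sigma>s \<tau> \<equiv> foldr (\<rightarrow>\<^sub>t) \<sigma>s \<tau>"

lemma args_funs [simp]: "args (funs \<sigma>s \<tau>) = \<sigma>s @ args \<tau>"
  by (induction \<sigma>s) simp_all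

lemma head_funs [simp]: "head (funs \<sigma>s \<tau>) = head \<tau>"
  by (induction \<sigma>s) simp_all

lemma sub_apps [simp]: "sub \<theta> (apps t ts) = apps (sub \<theta> t) (map (sub \<theta>) ts)"
  by (induction ts arbitrary: t) simp_all

lemma typing_apps:
  "\<Gamma> \<turnstile> apps t ts : \<tau> \<longleftrightarrow> (\<exists>\<sigma>s. list_all2 (typing \<Gamma>) ts \<sigma>s \<and> \<Gamma> \<turnstile> t : funs \<sigma>s \<tau>)"
proof (induction ts arbitrary: t)
  case (Cons u ts)
  show ?case
  proof
    assume "\<Gamma> \<turnstile> apps t (u # ts) : \<tau>"
    then obtain \<sigma>s where 1: "list_all2 (typing \<Gamma>) ts \<sigma>s" "\<Gamma> \<turnstile> App t u : funs \<sigma>s \<tau>"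
      using Cons by auto
    then obtain \<sigma> where "\<Gamma> \<turnstile> t : \<sigma> \<rightarrow>\<^sub>t funs \<sigma>s \<tau>" "\<Gamma> \<turnstile> u : \<sigma>"
      by (auto elim: typing_AppE)
    with 1 show "\<exists>\<sigma>s. list_all2 (typing \<Gamma>) (u # ts) \<sigma>s \<and> \<Gamma> \<turnstile> t : funs \<sigma>s \<tau>"
      by (intro exI[of _ "\<sigma> # \<sigma>s"]) simp
  next
    assume "\<exists>\<sigma>s. list_all2 (typing \<Gamma>) (u # ts) \<sigma>s \<and> \<Gamma> \<turnstile> t : funs \<sigma>s \<tau>"
    then obtain \<sigma> \<sigma>s where "\<Gamma> \<turnstile> u : \<sigma>" "list_all2 (typing \<Gamma>) ts \<sigma>s" "\<Gamma> \<turnstile> t : \<sigma> \<rightarrow>\<^sub>t funs \<sigma>s \<tau>"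
      by (auto simp: list_all2_Cons1)
    then show "\<Gamma> \<turnstile> apps t (u # ts) : \<tau>"
      using Cons ty_App by (metis foldl_Cons)
  qed
qed simp

lemma typing_apps_Var:
  "\<Gamma> \<turnstile> apps (Var i) ts : \<tau> \<longleftrightarrow>
     i < length \<Gamma> \<and> (\<exists>\<sigma>s. list_all2 (typing \<Gamma>) ts \<sigma>s \<and> \<Gamma> ! i = funs \<sigma>s \<tau>)"
  unfolding typing_apps by (auto elim!: typing_VarE intro: ty_Var')

text \<open>\<open>zip\<close> lets \<open>list_all2\<close> range over two argument lists and their
  types; the length condition prevents \<open>zip\<close> from truncating.\<close>

lemma be_apps:
  "list_all2 (\<lambda>(t, u) \<sigma>. \<Gamma> \<turnstile> t =\<^sub>\<beta>\<^sub>\<eta> u : \<sigma>) (zip ts us) \<sigma>s \<Longrightarrow> length ts = length us \<Longrightarrow>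
   \<Gamma> \<turnstile> s =\<^sub>\<beta>\<^sub>\<eta> t : funs \<sigma>s \<tau> \<Longrightarrow> \<Gamma> \<turnstile> apps s ts =\<^sub>\<beta>\<^sub>\<eta> apps t us : \<tau>"
proof (induction \<sigma>s arbitrary: ts us s t)
  case Nil
  then have "ts = []" "us = []" by (cases ts; cases us; simp)+
  with Nil show ?case by simp
next
  case (Cons \<sigma> \<sigma>s)
  then obtain t1 ts' u1 us' where [simp]: "ts = t1 # ts'" "us = u1 # us'"
    by (cases ts; cases us) auto
  show ?case using Cons.prems by (auto intro!: Cons.IH intro: be_App)
qed

lemma not_whr_apps_Var: "\<not> apps (Var i) ts \<leadsto> t"
proof (induction ts arbitrary: t rule: rev_induct)
  case Nil
  then show ?case by (auto elim: whr_VarE)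
next
  case (snoc u ts)
  have "apps (Var i) ts \<noteq> Lam \<sigma> s" for \<sigma> s
    by (cases ts rule: rev_cases) auto
  then show ?case using snoc.IH by (simp, metis whr_AppE)
qed

lemma ne_apps_Var:
  "ne \<Gamma> (apps (Var i) ts) n \<tau> \<Longrightarrow> ne \<Gamma> (apps (Var j) us) n \<tau>' \<Longrightarrow>
   i = j \<and> \<tau> = \<tau>' \<and> length us = length ts \<and> (\<exists>\<sigma>s. \<Gamma> ! i = funs \<sigma>s \<tau> \<and> length \<sigma>s = length ts \<and>
     (\<forall>m < length ts. \<exists>k. nf \<Gamma> (ts ! m) k (\<sigma>s ! m) \<and> nf \<Gamma> (us ! m) k (\<sigma>s ! m)))"
proof (induction ts arbitrary: us n \<tau> \<tau>' rule: rev_induct)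
  case Nil
  then have "n = Var i" "\<tau> = \<Gamma> ! i" by (auto elim: ne_VarE)
  with Nil.prems(2) show ?case
    by (cases us rule: rev_cases) (auto elim: ne_VarE ne_AppE)
next
  case (snoc t ts)
  from snoc.prems(1) obtain m k \<sigma> where
    n: "n = App m k" "ne \<Gamma> (apps (Var i) ts) m (\<sigma> \<rightarrow>\<^sub>t \<tau>)" "nf \<Gamma> t k \<sigma>"
    by (auto elim: ne_AppE)
  obtain us' u where us: "us = us' @ [u]"
    using snoc.prems(2) n(1) by (cases us rule: rev_cases) (auto elim: ne_VarE)
  obtain \<sigma>' where u: "ne \<Gamma> (apps (Var j) us') m (\<sigma>' \<rightarrow>\<^sub>t \<tau>')" "nf \<Gamma> u k \<sigma>'"
    using snoc.prems(2) n(1) us by (auto elim: ne_AppE)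
  from snoc.IH[OF n(2) u(1)] obtain \<sigma>s where IH: "i = j" "\<sigma> = \<sigma>'" "\<tau> = \<tau>'" "length us' = length ts"
    "\<Gamma> ! i = funs \<sigma>s (\<sigma> \<rightarrow>\<^sub>t \<tau>)" "length \<sigma>s = length ts"
    "\<forall>m < length ts. \<exists>k. nf \<Gamma> (ts ! m) k (\<sigma>s ! m) \<and> nf \<Gamma> (us' ! m) k (\<sigma>s ! m)"
    by auto
  then have "\<Gamma> ! i = funs (\<sigma>s @ [\<sigma>]) \<tau>" by simp
  moreover have "\<forall>m < length (ts @ [t]). \<exists>k. nf \<Gamma> ((ts @ [t]) ! m) k ((\<sigma>s @ [\<sigma>]) ! m) \<and>
      nf \<Gamma> (us ! m) k ((\<sigma>s @ [\<sigma>]) ! m)"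
    using IH n(3) u(2) by (auto simp: us nth_append less_Suc_eq)
  ultimately show ?case
    using IH us by (metis length_append_singleton)
qed

text \<open>At an atomic type the common normal form of two such spines must come from
  \<open>ne\<close>, since neither has a weak head step. Hence the heads agree and the arguments
  have pairwise common normal forms, which soundness turns back into conversions.\<close>

lemma be_apps_VarD:
  assumes eq: "\<Gamma> \<turnstile> apps (Var i) ts =\<^sub>\<beta>\<^sub>\<eta> apps (Var j) us : Atom a"
  shows "i = j" "length ts = length (args (\<Gamma> ! i))" "length us = length (args (\<Gamma> ! i))"
    "m < length (args (\<Gamma> ! i)) \<Longrightarrow> \<Gamma> \<turnstile> ts ! m =\<^sub>\<beta>\<^sub>\<eta> us ! m : args (\<Gamma> ! i) ! m"
proof -
  from eq obtain n where "nf \<Gamma> (apps (Var i) ts) n (Atom a)" "nf \<Gamma> (apps (Var j) us) n (Atom a)"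
    by (rule be_common_nf)
  then have "ne \<Gamma> (apps (Var i) ts) n (Atom a)" "ne \<Gamma> (apps (Var j) us) n (Atom a)"
    using not_whr_apps_Var by (auto elim: nf_AtomE)
  from ne_apps_Var[OF this] obtain \<sigma>s where *: "i = j" "length us = length ts"
    "\<Gamma> ! i = funs \<sigma>s (Atom a)" "length \<sigma>s = length ts"
    "\<forall>m < length ts. \<exists>k. nf \<Gamma> (ts ! m) k (\<sigma>s ! m) \<and> nf \<Gamma> (us ! m) k (\<sigma>s ! m)"
    by blast
  then show "i = j" "length ts = length (args (\<Gamma> ! i))" "length us = length (args (\<Gamma> ! i))"
    by simp_all
  assume "m < length (args (\<Gamma> ! i))"
  then have m: "m < length ts" using *(3,4) by simp
  then obtain k where k: "nf \<Gamma> (ts ! m) k (\<sigma>s ! m)" "nf \<Gamma> (us ! m) k (\<sigma>s ! m)"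
    using *(5) by blast
  have spine_args: "\<Gamma> \<turnstile> vs ! m : \<sigma>s ! m"
    if vs: "\<Gamma> \<turnstile> apps (Var i) vs : Atom a" "length vs = length ts" for vs
  proof -
    obtain \<sigma>s' where "list_all2 (typing \<Gamma>) vs \<sigma>s'" "\<Gamma> ! i = funs \<sigma>s' (Atom a)"
      using vs(1) unfolding typing_apps_Var by blast
    moreover from this(2) have "\<sigma>s' = \<sigma>s"
      using *(3) by (metis args_funs args.simps(1) append_Nil2)
    ultimately show ?thesis using m vs(2) by (simp add: list_all2_conv_all_nth)
  qed
  have "\<Gamma> \<turnstile> ts ! m : \<sigma>s ! m" "\<Gamma> \<turnstile> us ! m : \<sigma>s ! m"
    using be_typed[OF eq] *(1,2) by (simp_all add: spine_args)
  with k have "\<Gamma> \<turnstile> ts ! m =\<^sub>\<beta>\<^sub>\<eta> us ! m : \<sigma>s ! m"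
    by (blast intro: nf_be(1) be_sym be_trans)
  then show "\<Gamma> \<turnstile> ts ! m =\<^sub>\<beta>\<^sub>\<eta> us ! m : args (\<Gamma> ! i) ! m"
    using *(3) by simp
qed

text \<open>Every typed term satisfies this (\<open>typing_lnf\<close>), so its value is the
  induction rule: \<eta>-expand at an arrow, pass to a convertible term, or split a spine of atomic
  type. Because conversion is a rule, the term need not be replaced by its normal form.\<close>

inductive lnf :: "'a ty list \<Rightarrow> 'a ty \<Rightarrow> 'a tm \<Rightarrow> bool" where
  lnf_Fun: "\<Gamma> \<turnstile> s : \<sigma> \<rightarrow>\<^sub>t \<tau> \<Longrightarrow> lnf (\<sigma> # \<Gamma>) \<tau> (App (lift s 0) (Var 0)) \<Longrightarrow> lnf \<Gamma> (\<sigma> \<rightarrow>\<^sub>t \<tau>) s"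
| lnf_conv: "\<Gamma> \<turnstile> s =\<^sub>\<beta>\<^sub>\<eta> s' : \<tau> \<Longrightarrow> lnf \<Gamma> \<tau> s' \<Longrightarrow> lnf \<Gamma> \<tau> s"
| lnf_ne: "i < length \<Gamma> \<Longrightarrow> \<Gamma> ! i = funs \<sigma>s (Atom a) \<Longrightarrow>
    list_all2 (\<lambda>t \<sigma>. \<Gamma> \<turnstile> t : \<sigma> \<and> lnf \<Gamma> \<sigma> t) ts \<sigma>s \<Longrightarrow> lnf \<Gamma> (Atom a) (apps (Var i) ts)"

lemma nf_lnf:
  "nf \<Gamma> s n \<tau> \<Longrightarrow> \<Gamma> \<turnstile> s : \<tau> \<Longrightarrow> lnf \<Gamma> \<tau> s"
  "ne \<Gamma> p n \<tau> \<Longrightarrow> \<Gamma> \<turnstile> p : \<tau> \<Longrightarrow> \<exists>i ts \<sigma>s. p = apps (Var i) ts \<and> i < length \<Gamma> \<and>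
     \<Gamma> ! i = funs \<sigma>s \<tau> \<and> list_all2 (\<lambda>t \<sigma>. \<Gamma> \<turnstile> t : \<sigma> \<and> lnf \<Gamma> \<sigma> t) ts \<sigma>s"
proof (induction rule: nf_ne.inducts)
  case (nf_Fun \<sigma> \<Gamma> s n \<tau>)
  then show ?case by (blast intro: lnf_Fun typing_eta_body)
next
  case (nf_whr s s' \<Gamma> n a)
  then show ?case using whr_be be_typed lnf_conv by blast
next
  case (nf_ne \<Gamma> p n a)
  then obtain i ts \<sigma>s where p: "p = apps (Var i) ts" "i < length \<Gamma>" "\<Gamma> ! i = funs \<sigma>s (Atom a)"
    "list_all2 (\<lambda>t \<sigma>. \<Gamma> \<turnstile> t : \<sigma> \<and> lnf \<Gamma> \<sigma> t) ts \<sigma>s" by blast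
  show ?case unfolding p(1) by (rule lnf_ne[OF p(2-4)])
next
  case (ne_Var i \<Gamma>)
  show ?case
    by (rule exI[of _ i], rule exI[of _ "[]"], rule exI[of _ "[]"]) (simp add: ne_Var)
next
  case (ne_App \<Gamma> p m \<sigma> \<tau> s n)
  obtain \<sigma>' where "\<Gamma> \<turnstile> p : \<sigma>' \<rightarrow>\<^sub>t \<tau>" "\<Gamma> \<turnstile> s : \<sigma>'"
    using ne_App.prems by (blast elim: typing_AppE)
  moreover from nf_be(2)[OF ne_App.hyps(1) this(1)] have "\<sigma>' = \<sigma>" by blast
  ultimately have p: "\<Gamma> \<turnstile> p : \<sigma> \<rightarrow>\<^sub>t \<tau>" and s: "\<Gamma> \<turnstile> s : \<sigma>" by simp_all
  obtain i ts \<sigma>s where "p = apps (Var i) ts" "i < length \<Gamma>" "\<Gamma> ! i = funs \<sigma>s (\<sigma> \<rightarrow>\<^sub>t \<tau>)"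
    "list_all2 (\<lambda>t \<sigma>. \<Gamma> \<turnstile> t : \<sigma> \<and> lnf \<Gamma> \<sigma> t) ts \<sigma>s"
    using ne_App.IH(1)[OF p] by blast
  then show ?case
    using s ne_App.IH(2)[OF s]
    by (intro exI[of _ i] exI[of _ "ts @ [s]"] exI[of _ "\<sigma>s @ [\<sigma>]"]) (simp add: list_all2_appendI)
qed

theorem typing_lnf:
  assumes "\<Gamma> \<turnstile> t : \<tau>"
  shows "lnf \<Gamma> \<tau> t"
  by (rule be_common_nf[OF be_refl[OF assms]]) (rule nf_lnf(1)[OF _ assms])

section \<open>Terms that rename to a variable\<close>

lemma typing_ren_spine:
  assumes f: "ren_typed \<Gamma>' \<Gamma> f" and w: "w < length \<Gamma>'" and ws: "\<forall>v \<in> set ws. v < length \<Gamma>'"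
    and ty: "\<Gamma> \<turnstile> apps (Var (f w)) (map (\<lambda>v. Var (f v)) ws) : \<tau>"
  shows "\<Gamma>' \<turnstile> apps (Var w) (map Var ws) : \<tau>"
proof -
  obtain \<sigma>s where *: "list_all2 (typing \<Gamma>) (map (\<lambda>v. Var (f v)) ws) \<sigma>s" "\<Gamma> ! f w = funs \<sigma>s \<tau>"
    using ty unfolding typing_apps_Var by blast
  have "list_all2 (typing \<Gamma>') (map Var ws) \<sigma>s"
    using *(1) ws f
    by (auto simp: list_all2_conv_all_nth ren_typed_def intro!: ty_Var' elim!: typing_VarE)
  then show ?thesis using *(2) w f by (auto simp: typing_apps_Var ren_typed_def)
qed

text \<open>The variables \<open>ws\<close> stand for the \<open>\<eta>\<close>-expanded arguments; \<open>f\<close> identifies none of them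
  with another variable.\<close>

lemma ren_be_spine:
  "lnf \<Gamma>' \<tau> N \<Longrightarrow> ren_typed \<Gamma>' \<Gamma> f \<Longrightarrow>
   \<forall>v \<in> set ws. v < length \<Gamma>' \<and> (\<forall>v' < length \<Gamma>'. f v' = f v \<longrightarrow> v' = v) \<Longrightarrow>
   \<Gamma> \<turnstile> ren f N =\<^sub>\<beta>\<^sub>\<eta> apps (Var k) (map (\<lambda>v. Var (f v)) ws) : \<tau> \<Longrightarrow>
   \<exists>w < length \<Gamma>'. f w = k \<and> \<Gamma>' \<turnstile> N =\<^sub>\<beta>\<^sub>\<eta> apps (Var w) (map Var ws) : \<tau>"
proof (induction arbitrary: \<Gamma> f k ws rule: lnf.induct)
  case (lnf_Fun \<Gamma>' s \<sigma> \<tau>)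
  let ?ws = "map Suc ws @ [0]"
  have "\<sigma> # \<Gamma> \<turnstile> ren Suc (ren f s) =\<^sub>\<beta>\<^sub>\<eta> ren Suc (apps (Var k) (map (\<lambda>v. Var (f v)) ws)) : \<sigma> \<rightarrow>\<^sub>t \<tau>"
    by (rule be_ren[OF lnf_Fun.prems(3) ren_typed_Suc])
  then have "\<sigma> # \<Gamma> \<turnstile> App (ren Suc (ren f s)) (Var 0) =\<^sub>\<beta>\<^sub>\<eta>
      App (ren Suc (apps (Var k) (map (\<lambda>v. Var (f v)) ws))) (Var 0) : \<tau>"
    by (rule be_App) (simp add: be_refl ty_Var')
  also have "App (ren Suc (ren f s)) (Var 0) = ren (upr f) (App (lift s 0) (Var 0))"
    by (simp add: lift0 sub_sub)
  also have "App (ren Suc (apps (Var k) (map (\<lambda>v. Var (f v)) ws))) (Var 0) =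
      apps (Var (Suc k)) (map (\<lambda>v. Var (upr f v)) ?ws)"
    by (simp add: comp_def)
  finally have eq: "\<sigma> # \<Gamma> \<turnstile> ren (upr f) (App (lift s 0) (Var 0)) =\<^sub>\<beta>\<^sub>\<eta>
      apps (Var (Suc k)) (map (\<lambda>v. Var (upr f v)) ?ws) : \<tau>" .
  have ws: "\<forall>v \<in> set ?ws. v < length (\<sigma> # \<Gamma>') \<and>
      (\<forall>v' < length (\<sigma> # \<Gamma>'). upr f v' = upr f v \<longrightarrow> v' = v)"
    using lnf_Fun.prems(2) by (auto split: nat.splits)
  obtain w where w: "w < length (\<sigma> # \<Gamma>')" "upr f w = Suc k"
    and N: "\<sigma> # \<Gamma>' \<turnstile> App (lift s 0) (Var 0) =\<^sub>\<beta>\<^sub>\<eta> apps (Var w) (map Var ?ws) : \<tau>"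
    using lnf_Fun.IH[OF ren_typed_upr[OF lnf_Fun.prems(1)] ws eq] by blast
  obtain w' where w': "w = Suc w'" "w' < length \<Gamma>'" "f w' = k"
    using w by (cases w) auto
  have "\<Gamma>' \<turnstile> apps (Var w') (map Var ws) : \<sigma> \<rightarrow>\<^sub>t \<tau>"
    using lnf_Fun.prems be_typed w' by (intro typing_ren_spine[OF lnf_Fun.prems(1)]) blast+
  moreover have spine: "apps (Var w) (map Var ?ws) = App (lift (apps (Var w') (map Var ws)) 0) (Var 0)"
    by (simp add: lift0 w' comp_def)
  ultimately have "\<Gamma>' \<turnstile> s =\<^sub>\<beta>\<^sub>\<eta> apps (Var w') (map Var ws) : \<sigma> \<rightarrow>\<^sub>t \<tau>"
    using be_extI[OF lnf_Fun.hyps(1) _ N[unfolded spine]] by blast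
  then show ?case using w' by blast
next
  case (lnf_conv \<Gamma>' s s' \<tau>)
  have "\<Gamma> \<turnstile> ren f s' =\<^sub>\<beta>\<^sub>\<eta> apps (Var k) (map (\<lambda>v. Var (f v)) ws) : \<tau>"
    using be_ren[OF lnf_conv.hyps(1) lnf_conv.prems(1)] lnf_conv.prems(3) by (meson be_sym be_trans)
  then show ?case
    using lnf_conv.IH[OF lnf_conv.prems(1,2)] lnf_conv.hyps(1) be_trans by blast
next
  case (lnf_ne i \<Gamma>' \<sigma>s a ts)
  have \<Gamma>: "\<Gamma> ! f i = funs \<sigma>s (Atom a)"
    using lnf_ne by (simp add: ren_typed_def)
  have eq: "\<Gamma> \<turnstile> apps (Var (f i)) (map (ren f) ts) =\<^sub>\<beta>\<^sub>\<eta> apps (Var k) (map (\<lambda>v. Var (f v)) ws) : Atom a"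
    using lnf_ne.prems(3) by simp
  note D = be_apps_VarD[OF eq, unfolded \<Gamma>, simplified]
  have "\<Gamma>' \<turnstile> ts ! m =\<^sub>\<beta>\<^sub>\<eta> Var (ws ! m) : \<sigma>s ! m" if m: "m < length \<sigma>s" for m
  proof -
    \<comment> \<open>The induction hypothesis is used with an empty spine: the argument must itself
      be a variable over \<open>f (ws ! m)\<close>, and by the condition on \<open>ws\<close> only
      \<open>ws ! m\<close> qualifies.\<close>
    have "\<Gamma> \<turnstile> ren f (ts ! m) =\<^sub>\<beta>\<^sub>\<eta> apps (Var (f (ws ! m))) (map (\<lambda>v. Var (f v)) []) : \<sigma>s ! m"
      using D(4)[OF m] D(2,3) m by simp
    moreover have "\<forall>\<Gamma> f k ws. ren_typed \<Gamma>' \<Gamma> f \<longrightarrow>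
        (\<forall>v \<in> set ws. v < length \<Gamma>' \<and> (\<forall>v' < length \<Gamma>'. f v' = f v \<longrightarrow> v' = v)) \<longrightarrow>
        \<Gamma> \<turnstile> ren f (ts ! m) =\<^sub>\<beta>\<^sub>\<eta> apps (Var k) (map (\<lambda>v. Var (f v)) ws) : \<sigma>s ! m \<longrightarrow>
        (\<exists>w < length \<Gamma>'. f w = k \<and> \<Gamma>' \<turnstile> ts ! m =\<^sub>\<beta>\<^sub>\<eta> apps (Var w) (map Var ws) : \<sigma>s ! m)"
      using list_all2_nthD2[OF lnf_ne.IH m] by blast
    ultimately obtain w where "w < length \<Gamma>'" "f w = f (ws ! m)"
      "\<Gamma>' \<turnstile> ts ! m =\<^sub>\<beta>\<^sub>\<eta> apps (Var w) (map Var []) : \<sigma>s ! m"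
      using lnf_ne.prems(1) by (metis empty_iff empty_set)
    moreover have "ws ! m \<in> set ws" using D(3) m by simp
    ultimately show ?thesis using lnf_ne.prems(2) by auto
  qed
  then have "\<Gamma>' \<turnstile> apps (Var i) ts =\<^sub>\<beta>\<^sub>\<eta> apps (Var i) (map Var ws) : Atom a"
    using D lnf_ne.hyps
    by (intro be_apps[where \<sigma>s = \<sigma>s]) (auto simp: list_all2_conv_all_nth intro!: be_refl ty_Var')
  then show ?case using D(1) lnf_ne.hyps(1) by blast
qed

text \<open>\<open>f\<close> may merge variables here, since with the empty spine the injectivity
  condition is void. Merging variables cannot turn anything but a variable into a variable, up to
  conversion.\<close>

lemma ren_be_Var:
  assumes "\<Gamma>' \<turnstile> N : \<tau>" "ren_typed \<Gamma>' \<Gamma> f" "\<Gamma> \<turnstile> ren f N =\<^sub>\<beta>\<^sub>\<eta> Var k : \<tau>"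
  obtains w where "w < length \<Gamma>'" "f w = k" "\<Gamma>' \<turnstile> N =\<^sub>\<beta>\<^sub>\<eta> Var w : \<tau>"
  using ren_be_spine[OF typing_lnf[OF assms(1)] assms(2), of "[]" k] assms(3) that by auto

lemma be_apps_Var_head:
  "\<Gamma> \<turnstile> apps (Var i) ts =\<^sub>\<beta>\<^sub>\<eta> apps (Var j) us : \<tau> \<Longrightarrow> i = j"
proof (induction \<tau> arbitrary: \<Gamma> i j ts us)
  case (Atom a)
  then show ?case by (rule be_apps_VarD(1))
next
  case (Fun \<sigma> \<tau>)
  have "\<sigma> # \<Gamma> \<turnstile> App (ren Suc (apps (Var i) ts)) (Var 0) =\<^sub>\<beta>\<^sub>\<eta>
      App (ren Suc (apps (Var j) us)) (Var 0) : \<tau>"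
    by (rule be_App[OF be_ren[OF Fun.prems ren_typed_Suc]]) (simp add: be_refl ty_Var')
  then have "\<sigma> # \<Gamma> \<turnstile> apps (Var (Suc i)) (map (ren Suc) ts @ [Var 0]) =\<^sub>\<beta>\<^sub>\<eta>
      apps (Var (Suc j)) (map (ren Suc) us @ [Var 0]) : \<tau>"
    by simp
  then have "Suc i = Suc j" by (rule Fun.IH(2))
  then show ?case by simp
qed

lemma be_Var_inject: "\<Gamma> \<turnstile> Var i =\<^sub>\<beta>\<^sub>\<eta> Var j : \<tau> \<Longrightarrow> i = j"
  using be_apps_Var_head[of \<Gamma> i "[]" j "[]"] by simp

section \<open>Retractions onto a component of a substitution\<close>

text \<open>Each variable \<open>i\<close> of \<open>M\<close> gets its own copy of \<open>k\<close>, namely the new variable \<open>i\<close> put in front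
  of \<open>\<Delta>\<close>. Which copy comes out tells which component of \<open>\<theta>\<close> codes \<open>k\<close>; all other components
  can be absorbed into the decoder, as they do not mention this copy.\<close>

lemma retract_component:
  assumes M: "\<Gamma> \<turnstile> M : \<rho>" and \<theta>: "sub_typed \<Gamma> \<Delta> \<theta>" and k: "k < length \<Delta>"
    and eq: "\<Delta> \<turnstile> sub \<theta> M =\<^sub>\<beta>\<^sub>\<eta> Var k : \<rho>"
    and Z: "\<And>i. i < length \<Gamma> \<Longrightarrow> i \<notin> Z \<Longrightarrow> \<exists>j. j \<noteq> k \<and> \<theta> i = Var j"
  shows "\<exists>i \<in> Z. i < length \<Gamma> \<and> \<rho> \<unlhd> \<Gamma> ! i"
proof -
  define m where "m = length \<Gamma>"
  \<comment> \<open>One copy for each of the \<open>m\<close> variables of \<open>M\<close>, and a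
    spare one at index \<open>m\<close> that no component mentions.\<close>
  define \<Delta>' where "\<Delta>' = replicate (Suc m) \<rho> @ \<Delta>"
  define h where "h i j = (if j = k then i else Suc m + j)" for i j
  define \<theta>' where "\<theta>' i = ren (h i) (\<theta> i)" for i
  define f where "f j = (if j < Suc m then k else j - Suc m)" for j
  have \<rho>: "\<Delta> ! k = \<rho>"
    using be_typed[OF eq] by (auto elim: typing_VarE)
  have nth: "\<Delta>' ! j = (if j < Suc m then \<rho> else \<Delta> ! (j - Suc m))" for j
    unfolding \<Delta>'_def by (simp add: nth_append del: replicate_Suc)
  have len: "length \<Delta>' = Suc m + length \<Delta>" by (simp add: \<Delta>'_def)
  have h: "ren_typed \<Delta> \<Delta>' (h i)" if "i < m" for i
    using that \<rho> by (auto simp: ren_typed_def h_def nth len)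
  have f: "ren_typed \<Delta>' \<Delta> f"
    using \<rho> k by (auto simp: ren_typed_def f_def nth len)
  have \<theta>': "sub_typed \<Gamma> \<Delta>' \<theta>'"
    using \<theta> h unfolding sub_typed_def \<theta>'_def m_def by (blast intro: typing_ren)
  \<comment> \<open>\<open>f\<close> merges all copies with \<open>k\<close> again and thereby
    undoes the tagging, so the tagged term is convertible to one of the variables over
    \<open>k\<close>.\<close>
  have "ren f (sub \<theta>' M) = sub \<theta> M"
    unfolding ren_sub
  proof (rule sub_cong[OF M])
    fix i
    assume "i < length \<Gamma>"
    then have "f (h i j) = j" for j by (auto simp: f_def h_def m_def)
    then show "ren f (\<theta>' i) = \<theta> i" by (simp add: \<theta>'_def sub_sub)
  qed
  with eq obtain w where w: "w < length \<Delta>'" "f w = k" and out: "\<Delta>' \<turnstile> sub \<theta>' M =\<^sub>\<beta>\<^sub>\<eta> Var w : \<rho>"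
    using ren_be_Var[OF typing_sub[OF M \<theta>'] f] by metis
  have "w < m \<and> w \<in> Z"
  proof (rule ccontr)
    assume w': "\<not> (w < m \<and> w \<in> Z)"
    \<comment> \<open>If \<open>w\<close> were the original \<open>k\<close>, the spare copy, or the
      copy of a component outside \<open>Z\<close>, it would occur in no component of
      \<open>\<theta>'\<close>. Renaming it to a different variable \<open>w2\<close> of the same
      type would then leave the term fixed but change its value.\<close>
    define w2 where "w2 = (if w = Suc m + k then m else Suc m + k)"
    define g where "g j = (if j = w then w2 else j)" for j
    have ty: "\<Delta>' ! w = \<rho>" using be_typed[OF out] by (auto elim: typing_VarE)
    have g: "ren_typed \<Delta>' \<Delta>' g"
      using k ty \<rho> by (auto simp: ren_typed_def g_def w2_def nth len)
    have "ren g (sub \<theta>' M) = sub \<theta>' M"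
      unfolding ren_sub
    proof (rule sub_cong[OF M])
      fix i
      assume i: "i < length \<Gamma>"
      show "ren g (\<theta>' i) = \<theta>' i"
      proof (cases "i = w")
        case True
        then obtain j where "j \<noteq> k" "\<theta> i = Var j" using Z[OF i] w' i by (auto simp: m_def)
        then show ?thesis using True i by (simp add: \<theta>'_def h_def g_def m_def)
      next
        case False
        have "w < Suc m \<or> w = Suc m + k" using w(2) by (auto simp: f_def split: if_splits)
        then have "g (h i j) = h i j" for j using False i by (auto simp: g_def h_def m_def)
        then show ?thesis by (simp add: \<theta>'_def sub_sub)
      qed
    qed
    with be_ren[OF out g] have "\<Delta>' \<turnstile> sub \<theta>' M =\<^sub>\<beta>\<^sub>\<eta> Var w2 : \<rho>" by (simp add: g_def)
    with out have "w = w2" by (meson be_Var_inject be_sym be_trans)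
    then show False by (simp add: w2_def split: if_splits)
  qed
  then have wm: "w < m" and wZ: "w \<in> Z" by auto
  \<comment> \<open>The copy that betrays component \<open>w\<close> becomes the variable
    \<open>x\<close> of the retraction, at index 0; the coder is that component.\<close>
  define r where "r j = (if j = w then 0 else Suc j)" for j
  have r: "ren_typed \<Delta>' (\<rho> # \<Delta>') r"
    using wm by (auto simp: ren_typed_def r_def nth)
  define C where "C = ren r (\<theta>' w)"
  \<comment> \<open>The decoder is \<open>M\<close> with component \<open>w\<close> abstracted and
    all others filled in.\<close>
  define \<delta> where "\<delta> i = (if i = w then Var 0 else ren Suc (\<theta>' i))" for i
  have \<delta>: "sub_typed \<Gamma> (\<Gamma> ! w # \<Delta>') \<delta>"
    using \<theta>' by (auto simp: sub_typed_def \<delta>_def intro!: ty_Var' typing_ren[OF _ ren_typed_Suc])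
  have C: "\<rho> # \<Delta>' \<turnstile> C : \<Gamma> ! w"
    unfolding C_def using \<theta>' wm by (intro typing_ren[OF _ r]) (simp add: sub_typed_def m_def)
  have D: "\<Delta>' \<turnstile> Lam (\<Gamma> ! w) (sub \<delta> M) : \<Gamma> ! w \<rightarrow>\<^sub>t \<rho>"
    by (rule ty_Lam[OF typing_sub[OF M \<delta>]])
  have "sub (scons C Var) (sub (up (\<lambda>i. Var (Suc i))) (sub \<delta> M)) = ren r (sub \<theta>' M)"
    unfolding sub_sub
  proof (rule sub_cong[OF M])
    fix i
    assume i: "i < length \<Gamma>"
    show "sub (\<lambda>i. sub (scons C Var) (up (\<lambda>i. Var (Suc i)) i)) (\<delta> i) = ren r (\<theta>' i)"
    proof (cases "i = w")
      case True
      then show ?thesis by (simp add: \<delta>_def up_def C_def)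
    next
      case False
      have "r (h i j) = Suc (h i j)" for j
        using False wm by (auto simp: r_def h_def)
      then show ?thesis using False by (simp add: \<delta>_def \<theta>'_def up_def sub_sub lift0)
    qed
  qed
  then have red: "subst (sub (up (\<lambda>i. Var (Suc i))) (sub \<delta> M)) C 0 = ren r (sub \<theta>' M)"
    by (simp add: subst0)
  have "\<Gamma> ! w # \<rho> # \<Delta>' \<turnstile> sub (up (\<lambda>i. Var (Suc i))) (sub \<delta> M) : \<rho>"
    by (rule typing_sub[OF typing_sub[OF M \<delta>] sub_typed_up[OF sub_typed_ren[OF ren_typed_Suc]]])
  from be_beta[OF this C] have
    "\<rho> # \<Delta>' \<turnstile> App (lift (Lam (\<Gamma> ! w) (sub \<delta> M)) 0) C =\<^sub>\<beta>\<^sub>\<eta> ren r (sub \<theta>' M) : \<rho>"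
    by (simp only: red lift0 sub.simps)
  moreover have "\<rho> # \<Delta>' \<turnstile> ren r (sub \<theta>' M) =\<^sub>\<beta>\<^sub>\<eta> Var 0 : \<rho>"
    using be_ren[OF out r] by (simp add: r_def)
  ultimately have "\<rho> # \<Delta>' \<turnstile> App (lift (Lam (\<Gamma> ! w) (sub \<delta> M)) 0) C =\<^sub>\<beta>\<^sub>\<eta> Var 0 : \<rho>"
    by (rule be_trans)
  with C D have "\<rho> \<unlhd> \<Gamma> ! w" unfolding retract_def by blast
  then show ?thesis using wZ wm m_def by blast
qed

section \<open>Delayed arguments\<close>

text \<open>The inductive definition extends a path at its outer end, on the right. Descending
  further inside a part extends it at the inner end.\<close>

lemma part_Cons: "part w \<sigma>' \<tau> \<Longrightarrow> \<sigma> \<in> set (args \<sigma>') \<Longrightarrow> part (head \<sigma>' # w) \<sigma> \<tau>"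
proof (induction rule: part.induct)
  case (part_arg \<sigma>' \<tau>)
  then have "part ([head \<sigma>'] @ [head \<tau>]) \<sigma> \<tau>" by (blast intro: part.intros)
  then show ?case by simp
next
  case (part_nested \<tau>' \<tau> w \<sigma>')
  then have "part ((head \<sigma>' # w) @ [head \<tau>]) \<sigma> \<tau>" by (blast intro: part.intros)
  then show ?case by simp
qed

definition delayed :: "'a \<Rightarrow> 'a ty \<Rightarrow> 'a ty \<Rightarrow> bool" where
  "delayed a \<tau> \<sigma> \<longleftrightarrow> (\<exists>k. odd k \<and> part (replicate k a) \<sigma> \<tau>)"

text \<open>The condition satisfied by \<open>\<tau>\<close>, by its parts under the paths \<open>a\<^sup>k\<close> with \<open>k\<close> even, and by
  the types obtained from these by dropping arguments.\<close>

definition delayed_args :: "'a \<Rightarrow> 'a ty \<Rightarrow> 'a ty \<Rightarrow> bool" where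
  "delayed_args a \<tau> \<sigma> \<longleftrightarrow> (head \<sigma> = a \<longrightarrow> (\<forall>\<sigma>' \<in> set (args \<sigma>). delayed a \<tau> \<sigma>'))"

lemma delayed_args_self: "delayed_args a \<tau> \<tau>"
  unfolding delayed_args_def delayed_def
proof (intro impI ballI)
  fix \<sigma>'
  assume "head \<tau> = a" "\<sigma>' \<in> set (args \<tau>)"
  then have "part (replicate 1 a) \<sigma>' \<tau>" using part_arg by fastforce
  then show "\<exists>k. odd k \<and> part (replicate k a) \<sigma>' \<tau>" using odd_one by blast
qed

text \<open>Parity is kept because two levels are passed: from a variable to one of its arguments,
  and from there to a variable bound in that argument.\<close>

lemma delayed_args_arg:
  assumes "delayed a \<tau> \<sigma>" "head \<sigma> = a" "\<sigma>' \<in> set (args \<sigma>)"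
  shows "delayed_args a \<tau> \<sigma>'"
  unfolding delayed_args_def
proof (intro impI ballI)
  fix \<sigma>''
  assume *: "head \<sigma>' = a" "\<sigma>'' \<in> set (args \<sigma>')"
  obtain k where k: "odd k" "part (replicate k a) \<sigma> \<tau>" using assms(1) by (auto simp: delayed_def)
  have "part (a # a # replicate k a) \<sigma>'' \<tau>"
    using part_Cons[OF part_Cons[OF k(2) assms(3)] *(2)] assms(2) *(1) by simp
  then have "part (replicate (Suc (Suc k)) a) \<sigma>'' \<tau>" by simp
  moreover have "odd (Suc (Suc k))" using k(1) by simp
  ultimately show "delayed a \<tau> \<sigma>''" unfolding delayed_def by blast
qed

section \<open>A logical predicate for terms that reduce to a given spine\<close>

text \<open>\<open>r\<close> is the target and \<open>G\<close> the proposition that reaching it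
  must entail. Unlike in \<open>LR\<close> the environment is fixed: nothing is reified, so no fresh
  variables are called for.\<close>

primrec reducible :: "'a ty list \<Rightarrow> 'a \<Rightarrow> 'a tm \<Rightarrow> bool \<Rightarrow> 'a ty \<Rightarrow> 'a tm \<Rightarrow> bool" where
  "reducible \<Delta> a r G (Atom b) t \<longleftrightarrow>
     \<Delta> \<turnstile> t : Atom b \<and> (b = a \<longrightarrow> \<Delta> \<turnstile> t =\<^sub>\<beta>\<^sub>\<eta> r : Atom a \<longrightarrow> G)"
| "reducible \<Delta> a r G (\<sigma> \<rightarrow>\<^sub>t \<tau>) t \<longleftrightarrow>
     \<Delta> \<turnstile> t : \<sigma> \<rightarrow>\<^sub>t \<tau> \<and> (\<forall>s. reducible \<Delta> a r G \<sigma> s \<longrightarrow> reducible \<Delta> a r G \<tau> (App t s))"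

lemma reducible_typed: "reducible \<Delta> a r G \<sigma> t \<Longrightarrow> \<Delta> \<turnstile> t : \<sigma>"
  by (cases \<sigma>) simp_all

text \<open>After all arguments are supplied, the atom reached is not \<open>a\<close>, so the
  implication holds vacuously.\<close>

lemma reducible_head_neq: "head \<sigma> \<noteq> a \<Longrightarrow> \<Delta> \<turnstile> t : \<sigma> \<Longrightarrow> reducible \<Delta> a r G \<sigma> t"
proof (induction \<sigma> arbitrary: t)
  case (Fun \<sigma> \<tau>)
  have "reducible \<Delta> a r G \<tau> (App t s)" if "reducible \<Delta> a r G \<sigma> s" for s
    using Fun.prems by (intro Fun.IH(2) ty_App[OF _ reducible_typed[OF that]]) simp_all
  then show ?case using Fun.prems by simp
qed simp

lemma reducible_be: "\<Delta> \<turnstile> t =\<^sub>\<beta>\<^sub>\<eta> t' : \<sigma> \<Longrightarrow> reducible \<Delta> a r G \<sigma> t' \<Longrightarrow> reducible \<Delta> a r G \<sigma> t"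
proof (induction \<sigma> arbitrary: t t')
  case (Atom b)
  then show ?case using be_typed[OF Atom.prems(1)] by (auto intro: be_trans be_sym)
next
  case (Fun \<sigma> \<tau>)
  have "reducible \<Delta> a r G \<tau> (App t s)" if s: "reducible \<Delta> a r G \<sigma> s" for s
  proof (rule Fun.IH(2))
    show "\<Delta> \<turnstile> App t s =\<^sub>\<beta>\<^sub>\<eta> App t' s : \<tau>"
      by (rule be_App[OF Fun.prems(1) be_refl[OF reducible_typed[OF s]]])
    show "reducible \<Delta> a r G \<tau> (App t' s)" using Fun.prems(2) s by simp
  qed
  then show ?case using be_typed[OF Fun.prems(1)] by simp
qed

lemma reducible_apps:
  "list_all2 (reducible \<Delta> a r G) \<sigma>s ts \<Longrightarrow> reducible \<Delta> a r G (funs \<sigma>s \<tau>) t \<Longrightarrow> reducible \<Delta> a r G \<tau> (apps t ts)"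
  by (induction arbitrary: t rule: list_all2_induct) simp_all

lemma reducible_sub:
  "\<Gamma> \<turnstile> t : \<tau> \<Longrightarrow> \<forall>i < length \<Gamma>. reducible \<Delta> a r G (\<Gamma> ! i) (\<theta> i) \<Longrightarrow> reducible \<Delta> a r G \<tau> (sub \<theta> t)"
proof (induction arbitrary: \<theta> rule: typing.induct)
  case (ty_Var i E)
  then show ?case by simp
next
  case (ty_App E s \<sigma> \<tau> t)
  from ty_App.IH(1)[OF ty_App.prems] ty_App.IH(2)[OF ty_App.prems] show ?case by simp
next
  case (ty_Lam \<sigma> E t \<tau>)
  have \<theta>: "sub_typed E \<Delta> \<theta>"
    unfolding sub_typed_def using ty_Lam.prems by (simp add: reducible_typed[of \<Delta> a r G])
  have "reducible \<Delta> a r G \<tau> (App (sub \<theta> (Lam \<sigma> t)) s)" if s: "reducible \<Delta> a r G \<sigma> s" for s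
  proof (rule reducible_be)
    show "\<Delta> \<turnstile> App (sub \<theta> (Lam \<sigma> t)) s =\<^sub>\<beta>\<^sub>\<eta> sub (scons s \<theta>) t : \<tau>"
      using be_beta[OF typing_sub[OF ty_Lam.hyps sub_typed_up[OF \<theta>]] reducible_typed[OF s]]
      by (simp add: subst0_sub_up)
    show "reducible \<Delta> a r G \<tau> (sub (scons s \<theta>) t)"
      using ty_Lam.prems s by (intro ty_Lam.IH) (auto simp: scons_case nth_Cons split: nat.splits)
  qed
  moreover have "\<Delta> \<turnstile> sub \<theta> (Lam \<sigma> t) : \<sigma> \<rightarrow>\<^sub>t \<tau>"
    by (rule typing_sub[OF typing.ty_Lam[OF ty_Lam.hyps] \<theta>])
  ultimately show ?case by (simp del: sub.simps)
qed

text \<open>Convertible spines have the same head variable, so this one never meets the target. Only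
  the head variable \<open>j\<close> of the target is left out.\<close>

lemma reducible_spine:
  "i \<noteq> j \<Longrightarrow> \<Delta> \<turnstile> apps (Var i) ts : \<sigma> \<Longrightarrow> reducible \<Delta> a (apps (Var j) us) G \<sigma> (apps (Var i) ts)"
proof (induction \<sigma> arbitrary: ts)
  case (Atom b)
  then show ?case using be_apps_Var_head[of \<Delta> i ts j us] by auto
next
  case (Fun \<sigma> \<tau>)
  have "reducible \<Delta> a (apps (Var j) us) G \<tau> (App (apps (Var i) ts) s)"
    if "reducible \<Delta> a (apps (Var j) us) G \<sigma> s" for s
    using Fun.IH(2)[OF Fun.prems(1), of "ts @ [s]"] ty_App[OF Fun.prems(2) reducible_typed[OF that]]
    by simp
  then show ?case using Fun.prems by simp
qed

text \<open>In a normal form, a variable bound by the coder can only come to the head at type \<open>a\<close> if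
  its type is a delayed argument of \<open>\<tau>\<close>. When \<open>x\<close> itself comes to the head, its arguments become
  the variables \<open>0, 1, \<dots>\<close> after the substitution, so lemma \<open>retract_component\<close> applies to them.\<close>

lemma reducible_coder:
  fixes \<rho> :: "'a ty" and E :: "'a ty list"
  defines "l \<equiv> length (args \<rho>)"
  defines "\<Delta> \<equiv> args \<rho> @ \<rho> # E"
  assumes G: "(\<And>i. i < l \<Longrightarrow> \<exists>\<sigma>. delayed (head \<rho>) \<tau> \<sigma> \<and> args \<rho> ! i \<unlhd> \<sigma>) \<Longrightarrow> G"
  shows "lnf \<Gamma> \<sigma> t \<Longrightarrow> \<Gamma> = Zs @ \<rho> # E \<Longrightarrow> \<forall>\<zeta> \<in> set Zs. delayed (head \<rho>) \<tau> \<zeta> \<Longrightarrow>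
    delayed_args (head \<rho>) \<tau> \<sigma> \<Longrightarrow>
    \<forall>i < length Zs. reducible \<Delta> (head \<rho>) (apps (Var l) (map Var [0..<l])) G (Zs ! i) (\<theta> i) \<Longrightarrow>
    \<forall>i. \<theta> (length Zs + i) = Var (l + i) \<Longrightarrow>
    reducible \<Delta> (head \<rho>) (apps (Var l) (map Var [0..<l])) G \<sigma> (sub \<theta> t)"
proof (induction arbitrary: Zs \<theta> rule: lnf.induct)
  let ?L = "reducible \<Delta> (head \<rho>) (apps (Var l) (map Var [0..<l])) G"
  have sub_typed: "sub_typed \<Gamma> \<Delta> \<theta>" if "\<Gamma> = Zs @ \<rho> # E"
    "\<forall>i < length Zs. ?L (Zs ! i) (\<theta> i)" "\<forall>i. \<theta> (length Zs + i) = Var (l + i)" for \<Gamma> Zs \<theta>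
    unfolding sub_typed_def
  proof (intro allI impI)
    fix i
    assume i: "i < length \<Gamma>"
    show "\<Delta> \<turnstile> \<theta> i : \<Gamma> ! i"
    proof (cases "i < length Zs")
      case True
      then have "?L (Zs ! i) (\<theta> i)" using that(2) by blast
      then show ?thesis using True that(1) by (simp add: nth_append reducible_typed[where G = G])
    next
      case False
      then obtain m where m: "i = length Zs + m" using le_Suc_ex not_less by blast
      then show ?thesis using that i by (auto simp: \<Delta>_def l_def nth_append intro!: ty_Var')
    qed
  qed
  {
    case (lnf_Fun \<Gamma> s \<sigma> \<tau>')
    note ty = typing_sub[OF lnf_Fun.hyps(1) sub_typed[OF lnf_Fun.prems(1,4,5)]]
    show ?case
    proof (cases "head \<tau>' = head \<rho>")
      case True
      have "?L \<tau>' (App (sub \<theta> s) u)" if u: "?L \<sigma> u" for u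
      proof -
        \<comment> \<open>The newly bound variable joins \<open>Zs\<close>. Its type is delayed, as
          it is an argument of a type with head \<open>head \<rho>\<close> that satisfies
          \<open>delayed_args\<close>.\<close>
        have "?L \<tau>' (sub (scons u \<theta>) (App (lift s 0) (Var 0)))"
        proof (rule lnf_Fun.IH[of "\<sigma> # Zs"])
          show "\<forall>\<zeta> \<in> set (\<sigma> # Zs). delayed (head \<rho>) \<tau> \<zeta>" "delayed_args (head \<rho>) \<tau> \<tau>'"
            using lnf_Fun.prems(2,3) True by (auto simp: delayed_args_def)
          show "\<forall>i < length (\<sigma> # Zs). ?L ((\<sigma> # Zs) ! i) (scons u \<theta> i)"
            using lnf_Fun.prems(4) u by (auto simp: scons_case nth_Cons split: nat.splits)
        qed (use lnf_Fun.prems in simp_all)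
        then show ?thesis by simp
      qed
      then show ?thesis using ty by simp
    next
      case False
      then show ?thesis using ty by (intro reducible_head_neq) simp_all
    qed
  next
    case (lnf_conv \<Gamma> s s' \<sigma>)
    show ?case
      by (rule reducible_be[OF be_sub[OF lnf_conv.hyps(1) sub_typed[OF lnf_conv.prems(1,4,5)]]
            lnf_conv.IH[OF lnf_conv.prems]])
  next
    case (lnf_ne i \<Gamma> \<sigma>s b ts)
    note \<theta> = sub_typed[OF lnf_ne.prems(1,4,5)]
    have ts: "list_all2 (typing \<Gamma>) ts \<sigma>s" by (rule list_all2_mono[OF lnf_ne.IH]) blast
    then have "\<Gamma> \<turnstile> apps (Var i) ts : Atom b"
      using lnf_ne.hyps unfolding typing_apps_Var by blast
    note ty = typing_sub[OF this \<theta>]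
    consider (local) "i < length Zs" | (global) m where "i = length Zs + m"
      using le_Suc_ex not_less by blast
    then show ?case
    proof cases
      case local
      then have Z: "Zs ! i = funs \<sigma>s (Atom b)"
        using lnf_ne.hyps(2) lnf_ne.prems(1) by (simp add: nth_append)
      have del: "delayed (head \<rho>) \<tau> (Zs ! i)"
        using lnf_ne.prems(2) local by simp
      show ?thesis
      proof (cases "b = head \<rho>")
        case True
        have "list_all2 ?L \<sigma>s (map (sub \<theta>) ts)"
          unfolding list_all2_conv_all_nth
        proof (intro conjI allI impI)
          show len: "length \<sigma>s = length (map (sub \<theta>) ts)"
            using list_all2_lengthD[OF ts] by simp
          fix m
          assume m: "m < length \<sigma>s"
          have "delayed_args (head \<rho>) \<tau> (\<sigma>s ! m)"
            using m True by (intro delayed_args_arg[OF del]) (simp_all add: Z)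
          then have "?L (\<sigma>s ! m) (sub \<theta> (ts ! m))"
            using list_all2_nthD2[OF lnf_ne.IH m] lnf_ne.prems by blast
          then show "?L (\<sigma>s ! m) (map (sub \<theta>) ts ! m)" using m len by simp
        qed
        moreover have "?L (funs \<sigma>s (Atom b)) (\<theta> i)"
          using lnf_ne.prems(4) local Z by metis
        ultimately show ?thesis by (simp add: reducible_apps del: reducible.simps)
      next
        case False
        then show ?thesis using ty by (intro reducible_head_neq) simp_all
      qed
    next
      case global
      then have \<theta>i: "\<theta> i = Var (l + m)" using lnf_ne.prems(5) by simp
      show ?thesis
      proof (cases m)
        case 0
        then have \<rho>: "\<rho> = funs \<sigma>s (Atom b)" and \<theta>i: "\<theta> i = Var l"
          using \<theta>i global lnf_ne.hyps(2) lnf_ne.prems(1) by simp_all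
        have \<Delta>l: "\<Delta> ! l = \<rho>" by (simp add: \<Delta>_def l_def)
        \<comment> \<open>Here \<open>x\<close> heads both the term and the target, so the equation
          is not absurd and has to be exploited: by injectivity of spines, the \<open>j\<close>-th
          argument of \<open>x\<close> becomes the variable \<open>j\<close>.\<close>
        have G if "\<Delta> \<turnstile> sub \<theta> (apps (Var i) ts) =\<^sub>\<beta>\<^sub>\<eta> apps (Var l) (map Var [0..<l]) : Atom (head \<rho>)"
        proof (rule G)
          fix j
          assume j: "j < l"
          have j\<sigma>: "j < length \<sigma>s" using j \<rho> unfolding l_def by (metis append_Nil2 args.simps(1) args_funs)
          have eq: "\<Delta> \<turnstile> apps (Var l) (map (sub \<theta>) ts) =\<^sub>\<beta>\<^sub>\<eta> apps (Var l) (map Var [0..<l]) : Atom (head \<rho>)"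
            using that \<theta>i by simp
          have "\<Delta> \<turnstile> sub \<theta> (ts ! j) =\<^sub>\<beta>\<^sub>\<eta> Var j : args \<rho> ! j"
            using be_apps_VarD(2)[OF eq, unfolded \<Delta>l] be_apps_VarD(4)[OF eq, of j, unfolded \<Delta>l] j
            by (simp add: l_def)
          moreover have "\<Gamma> \<turnstile> ts ! j : args \<rho> ! j"
            using list_all2_nthD2[OF ts j\<sigma>] \<rho> by (metis append_Nil2 args.simps(1) args_funs)
          \<comment> \<open>Variables outside \<open>Zs\<close> are sent to indices at least
            \<open>l\<close>, beyond the fresh arguments. Hence the component that codes variable
            \<open>j\<close> belongs to a variable bound in the coder.\<close>
          moreover have "\<exists>j'. j' \<noteq> j \<and> \<theta> i' = Var j'" if "i' \<notin> {..<length Zs}" for i'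
          proof -
            from that obtain n where "i' = length Zs + n" using le_Suc_ex not_less by blast
            then show ?thesis using lnf_ne.prems(5) j by auto
          qed
          moreover have "j < length \<Delta>" using j by (simp add: \<Delta>_def l_def)
          ultimately obtain z where z: "z < length Zs" "args \<rho> ! j \<unlhd> \<Gamma> ! z"
            using retract_component[OF _ \<theta>, of "ts ! j" "args \<rho> ! j" j "{..<length Zs}"] by blast
          then have "\<Gamma> ! z = Zs ! z" using lnf_ne.prems(1) by (simp add: nth_append)
          then show "\<exists>\<sigma>. delayed (head \<rho>) \<tau> \<sigma> \<and> args \<rho> ! j \<unlhd> \<sigma>"
            using z lnf_ne.prems(2) by (metis nth_mem)
        qed
        then show ?thesis using ty by (auto simp del: sub_apps)
      next
        case (Suc n)
        then show ?thesis
          using ty \<theta>i reducible_spine[of "l + m" l \<Delta> "map (sub \<theta>) ts" "Atom b"] by (simp del: reducible.simps)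
      qed
    qed
  }
qed

theorem theorem4p4:
  fixes \<rho> \<tau> :: "'a ty"
  assumes "\<rho> \<unlhd> \<tau>"
  shows "head \<rho> = head \<tau> \<and>
    (\<forall>i < length (args \<rho>). \<exists>\<tau>'. delayed_argument \<tau>' \<tau> \<and> args \<rho> ! i \<unlhd> \<tau>')" (is ?G)
proof -
  obtain E C D where C: "\<rho> # E \<turnstile> C : \<tau>" and D: "E \<turnstile> D : \<tau> \<rightarrow>\<^sub>t \<rho>"
    and eq: "\<rho> # E \<turnstile> App (lift D 0) C =\<^sub>\<beta>\<^sub>\<eta> Var 0 : \<rho>"
    using assms unfolding retract_def by blast
  define l where "l = length (args \<rho>)"
  define \<Delta> where "\<Delta> = args \<rho> @ \<rho> # E"
  define xs :: "'a tm list" where "xs = map Var [0..<l]"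
  let ?L = "reducible \<Delta> (head \<rho>) (apps (Var l) xs) ?G"
  \<comment> \<open>The \<open>l\<close> fresh arguments are placed in front of the environment. The
    decoder skips \<open>x\<close> as well, which accounts for the additional
    \<open>Suc\<close>.\<close>
  let ?D = "sub (\<lambda>i. Var (l + Suc i)) D" and ?C = "ren (\<lambda>i. l + i) C"
  have shift: "ren_typed (\<rho> # E) \<Delta> (\<lambda>i. l + i)"
    by (simp add: ren_typed_def \<Delta>_def l_def nth_append)
  have xs: "list_all2 (typing \<Delta>) xs (args \<rho>)"
    by (auto simp: list_all2_conv_all_nth xs_def l_def \<Delta>_def nth_append intro!: ty_Var')
  have var: "?L (\<Delta> ! i) (Var i)" if "i < length \<Delta>" "i \<noteq> l" for i
    using reducible_spine[OF that(2), of \<Delta> "[]"] that(1) by (simp add: ty_Var)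
  have "?L (\<tau> \<rightarrow>\<^sub>t \<rho>) ?D"
  proof (rule reducible_sub[OF D], intro allI impI)
    fix i
    assume "i < length E"
    then show "?L (E ! i) (Var (l + Suc i))"
      using var[of "l + Suc i"] by (simp add: \<Delta>_def l_def nth_append)
  qed
  moreover have "?L \<tau> ?C"
  proof (cases "head \<tau> = head \<rho>")
    case True
    have G: ?G if "\<And>i. i < length (args \<rho>) \<Longrightarrow> \<exists>\<sigma>. delayed (head \<rho>) \<tau> \<sigma> \<and> args \<rho> ! i \<unlhd> \<sigma>"
      using that True unfolding delayed_def delayed_argument_def by metis
    show ?thesis
      unfolding \<Delta>_def l_def xs_def
      by (rule reducible_coder[where Zs = "[]" and \<tau> = \<tau>, OF G typing_lnf[OF C]])
        (simp_all add: delayed_args_self)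
  next
    \<comment> \<open>With different heads the coder is reducible at once, so the conclusion below
      still yields \<open>?G\<close>; its first conjunct then refutes this case.\<close>
    case False
    then show ?thesis by (rule reducible_head_neq[OF _ typing_ren[OF C shift]])
  qed
  ultimately have DC: "?L \<rho> (App ?D ?C)" by simp
  have "list_all2 ?L (args \<rho>) xs"
    unfolding list_all2_conv_all_nth
  proof (intro conjI allI impI)
    show "length (args \<rho>) = length xs" by (simp add: xs_def l_def)
    fix i
    assume "i < length (args \<rho>)"
    then show "?L (args \<rho> ! i) (xs ! i)"
      using var[of i] by (simp add: xs_def l_def \<Delta>_def nth_append)
  qed
  with DC have "?L (Atom (head \<rho>)) (apps (App ?D ?C) xs)"
    by (intro reducible_apps[where \<sigma>s = "args \<rho>"]) (simp_all add: ty_decomp)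
  moreover have "\<Delta> \<turnstile> apps (App ?D ?C) xs =\<^sub>\<beta>\<^sub>\<eta> apps (Var l) xs : Atom (head \<rho>)"
  proof (rule be_apps[where \<sigma>s = "args \<rho>"])
    show "list_all2 (\<lambda>(t, u) \<sigma>. \<Delta> \<turnstile> t =\<^sub>\<beta>\<^sub>\<eta> u : \<sigma>) (zip xs xs) (args \<rho>)"
      using xs by (auto simp: list_all2_conv_all_nth intro: be_refl)
    show "\<Delta> \<turnstile> App ?D ?C =\<^sub>\<beta>\<^sub>\<eta> Var l : funs (args \<rho>) (Atom (head \<rho>))"
      using be_ren[OF eq shift] by (simp add: ty_decomp lift0 sub_sub)
  qed simp
  ultimately show ?G by simp
qed

end
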